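(* Let $k\ge 1$ and $m \ge 1$ be integers and let $E=\{v_1,\dots,v_N\}\subset \mathbf{R}^m\setminus\{0\}$ be a generic set of vectors. Suppose that $(1/p_j,\lambda_j)_{j=1}^N\in((0,1)\times\mathbf{R})^N$ and that all of the following conditions hold: \begin{align*} &\text{(i)}\quad \sum_{j=1}^N\Big(\frac1{p_j}+\frac{\lambda_j}{k}\Big)=m;\\ &\text{(ii)}\quad \sum_{j:\,v_j\notin V}\Big(\frac1{p_j}+\frac{\lambda_j}{k}\Big)>m-\dim(V)\quad\text{for all non-zero, proper subspaces } V \text{ of } \mathbf{R}^m;\\ &\text{(iii)}\quad \sum_{j:\,v_j\notin V}\lambda_j\ge 0\quad\text{for all subspaces } V \text{ of } \mathbf{R}^m;\\ &\text{(iv)}\quad \sum_{j=1}^N\frac1{p_j}\ge 1. \end{align*} Then there is a finite constant $C$ (depending only on $E$, $k$ and the indices $(1/p_j,\lambda_j)_{j=1}^N$) such that for all non-negative measurable functions $f_1,\dots,f_N$ on $\mathbf{R}^k$, $$\Lambda(f_1,\dots,f_N)\le C\prod_{j=1}^N\|f_j\|_{L^{p_j}_{\lambda_j}}.$$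
   Context: The vectors $v_1,\dots,v_N$ are distinct and non-zero, and no two of them are collinear. The set $E=\{v_1,\dots,v_N\}\subset\mathbf{R}^m$ is called generic if every subset $K\subset E$ with cardinality $\#K=m$ is a basis of $\mathbf{R}^m$. For $v=(v^1,\dots,v^m)\in\mathbf{R}^m$ and $x=(x^1,\dots,x^m)\in\mathbf{R}^{mk}$ with each $x^i\in\mathbf{R}^k$, define $v\cdot x=\sum_{i=1}^m v^ix^i\in\mathbf{R}^k$. For non-negative measurable functions $f_1,\dots,f_N$ on $\mathbf{R}^k$, the form $\Lambda$ is $$\Lambda(f_1,\dots,f_N)=\int_{\mathbf{R}^{km}}\prod_{i=1}^N f_i(v_i\cdot x)\,dx\in[0,\infty].$$ The weighted space $L^p_\alpha=L^p_\alpha(\mathbf{R}^k)$ has norm $\|f\|_{L^p_\alpha}=\|\,|\cdot|^\alpha f\|_{L^p(\mathbf{R}^k)}$ (possibly $+\infty$; the convention $0\cdot\infty=0$ is used in products). *)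

theory Defs
  imports "HOL-Analysis.Analysis"
begin

definition generic :: "(real ^ 'm) set \<Rightarrow> bool" where
  "generic E \<longleftrightarrow>
     (\<forall>K. K \<subseteq> E \<and> card K = CARD('m) \<longrightarrow> independent K \<and> span K = UNIV)"

text \<open>A point \<open>x = (x\<^sup>1, \<dots>, x\<^sup>m)\<close> of \<open>\<real>\<^sup>m\<^sup>k\<close> is an element of \<^typ>\<open>real ^ 'k ^ 'm\<close>; its
  block \<open>x\<^sup>i\<close> is \<open>x $ i\<close>.\<close>

definition block_dot :: "real ^ 'm \<Rightarrow> real ^ 'k ^ 'm \<Rightarrow> real ^ 'k" where
  "block_dot v x = (\<Sum>i\<in>UNIV. (v $ i) *\<^sub>R (x $ i))"

definition Lambda_form ::
  "nat \<Rightarrow> (nat \<Rightarrow> real ^ 'm) \<Rightarrow> (nat \<Rightarrow> real ^ 'k \<Rightarrow> real) \<Rightarrow> ennreal" where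
  "Lambda_form N v f =
     (\<integral>\<^sup>+ x. ennreal (\<Prod>i=1..N. f i (block_dot (v i) x)) \<partial>(lebesgue :: (real ^ 'k ^ 'm) measure))"

text \<open>Only meant for exponents \<open>0 < p < \<infinity>\<close>. The case distinction extends the power \<open>1 / p\<close>
  to the value \<open>\<infinity>\<close>.\<close>

definition Lp_norm :: "real \<Rightarrow> ('a::euclidean_space \<Rightarrow> real) \<Rightarrow> ennreal" where
  "Lp_norm p f =
     (let I = (\<integral>\<^sup>+ y. ennreal (\<bar>f y\<bar> powr p) \<partial>lebesgue)
      in if I = \<infinity> then \<infinity> else ennreal (enn2real I powr (1 / p)))"

text \<open>Since \<open>0 powr a = 0\<close> for every \<open>a\<close>, the weight is \<open>0\<close> at the origin even when \<open>a \<le> 0\<close>.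
  The origin is a null set, so the norm does not depend on this value.\<close>

definition weighted_Lp_norm :: "real \<Rightarrow> real \<Rightarrow> ('a::euclidean_space \<Rightarrow> real) \<Rightarrow> ennreal" where
  "weighted_Lp_norm p a f = Lp_norm p (\<lambda>y. norm y powr a * f y)"

end

theory Submission
  imports Defs
begin

text \<open>
  Write \<open>a j = 1 / p j\<close>, \<open>c j = a j + l j / k\<close> and \<open>m\<close> for the number of blocks. Genericity and
  the hypotheses reduce to three facts: \<open>c j < 1\<close> for all \<open>j\<close>, any \<open>m\<close> of the vectors form a basis,
  and the sum of the \<open>l j\<close> over all but at most \<open>m - 1\<close> indices is nonnegative.

  Negative weights are removed pointwise: all but at most \<open>m - 1\<close> of the blocks have size comparable
  to \<open>norm x\<close>, so weights can be moved between these blocks.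

  When all weights are nonnegative, \<open>f j\<close> lies in the Lorentz space with exponents \<open>1 / c j\<close> and
  \<open>1 / a j\<close>, that is, it is dominated by dyadic pieces
  \<open>x j n powr a j * 2 powr (- c j * n)\<close> on sets of measure at most \<open>2 powr n\<close> up to a constant, with
  \<open>x j\<close> summable over \<open>n\<close>. For pieces at levels \<open>n j\<close>, a change of variables bounds the form by the
  product of the measures over any \<open>m\<close> of the indices. As \<open>c\<close> lies in the interior of the hypersimplex
  spanned by the indicators of the \<open>m\<close>-element sets, the best choice gains a factor that is
  exponentially small in the distances between the levels, so that only the sum over a common level
  remains. It converges because the exponents \<open>a j\<close> add up to at least 1.
\<close>

section \<open>Dyadic sums and the hypersimplex\<close>

text \<open>Greedy choice: each induction step adds a minimizer of \<open>w\<close> on the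
  complement of the set chosen so far.\<close>

lemma ex_card_smallest:
  fixes w :: "'a \<Rightarrow> real"
  assumes "finite I" "m \<le> card I"
  shows "\<exists>K\<subseteq>I. card K = m \<and> (\<forall>a\<in>K. \<forall>b\<in>I - K. w a \<le> w b)"
  using assms(2)
proof (induction m)
  case 0
  then show ?case by (intro exI[of _ "{}"]) auto
next
  case (Suc m)
  then obtain K where K: "K \<subseteq> I" "card K = m" "\<forall>a\<in>K. \<forall>b\<in>I - K. w a \<le> w b"
    by auto
  have "finite (I - K)" using assms(1) by simp
  moreover have "I - K \<noteq> {}"
    using Suc.prems K by auto
  ultimately have "arg_min_on w (I - K) \<in> I - K" "\<forall>b\<in>I - K. w (arg_min_on w (I - K)) \<le> w b"
    using arg_min_if_finite(1)[of "I - K" w] arg_min_least[of "I - K" _ w] by auto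
  then obtain z where z: "z \<in> I - K" "\<forall>b\<in>I - K. w z \<le> w b" by blast
  have "finite K" using K(1) assms(1) finite_subset by auto
  then show ?case
    using K z by (intro exI[of _ "insert z K"]) auto
qed

text \<open>The set \<open>K\<close> collects the \<open>m\<close> smallest values; both sums are compared with the
  threshold \<open>t\<close> that separates them from the rest.\<close>

lemma vertex_dominates_interior_point:
  fixes c w :: "'a \<Rightarrow> real"
  assumes fin: "finite I" and sum_c: "sum c I = real m" and "m > 0" and i: "i \<in> I"
    and c: "\<And>j. j \<in> I \<Longrightarrow> \<epsilon> \<le> c j" "\<And>j. j \<in> I \<Longrightarrow> \<epsilon> \<le> 1 - c j" and "\<epsilon> > 0"
    and \<eta>: "\<eta> = \<epsilon> / (real (card I) + 1)"
  shows "\<exists>K\<subseteq>I. card K = m \<and>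
           (\<Sum>j\<in>K. w j + \<eta> * \<bar>w j - w i\<bar>) \<le> (\<Sum>j\<in>I. c j * w j)"
proof -
  have "real m \<le> (\<Sum>j\<in>I. 1)"
    unfolding sum_c[symmetric] using c \<open>\<epsilon> > 0\<close> by (intro sum_mono) force
  hence "m \<le> card I" by simp
  then obtain K where K: "K \<subseteq> I" "card K = m" "\<forall>a\<in>K. \<forall>b\<in>I - K. w a \<le> w b"
    using ex_card_smallest[OF fin] by blast
  have finK: "finite K" using K(1) fin finite_subset by auto
  have "K \<noteq> {}" using K(2) \<open>m > 0\<close> by auto
  define t where "t = Max (w ` K)"
  have tK: "w j \<le> t" if "j \<in> K" for j using that finK by (simp add: t_def)
  have "t \<in> w ` K" unfolding t_def using finK \<open>K \<noteq> {}\<close> by (intro Max_in) auto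
  hence tI: "t \<le> w j" if "j \<in> I - K" for j using that K(3) by auto
  define d where "d = (\<Sum>j\<in>I. \<bar>w j - t\<bar>)"
  have split: "sum h I = sum h K + sum h (I - K)" for h :: "'a \<Rightarrow> real"
    using sum.subset_diff[OF K(1) fin, of h] by simp
  \<comment> \<open>Both families of coefficients add up to \<open>m\<close>, as
    \<open>card K = m\<close> and \<open>sum c I = m\<close>. Hence \<open>t\<close> may be
    subtracted from \<open>w\<close> in both sums.\<close>
  have "(\<Sum>j\<in>K. w j) - (\<Sum>j\<in>I. c j * w j) = (\<Sum>j\<in>K. w j - t) - (\<Sum>j\<in>I. c j * (w j - t))"
    using sum_c K(2) by (simp add: sum_subtractf algebra_simps flip: sum_distrib_left)
  also have "\<dots> = (\<Sum>j\<in>K. (1 - c j) * (w j - t)) + (\<Sum>j\<in>I - K. - c j * (w j - t))"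
    unfolding split by (simp add: left_diff_distrib sum_subtractf sum_negf)
  \<comment> \<open>On \<open>K\<close> the value \<open>w j - t\<close> is nonpositive with
    coefficient at least \<open>\<epsilon>\<close>; off \<open>K\<close> it is nonnegative with
    coefficient at most \<open>- \<epsilon>\<close>. So each index gains
    \<open>\<epsilon> * \<bar>w j - t\<bar>\<close>.\<close>
  also have "\<dots> \<le> (\<Sum>j\<in>K. - (\<epsilon> * \<bar>w j - t\<bar>)) + (\<Sum>j\<in>I - K. - (\<epsilon> * \<bar>w j - t\<bar>))"
  proof (intro add_mono sum_mono)
    fix j assume j: "j \<in> K"
    hence "\<epsilon> * \<bar>w j - t\<bar> \<le> (1 - c j) * \<bar>w j - t\<bar>"
      using c(2)[of j] K(1) by (intro mult_right_mono) auto
    moreover have "\<bar>w j - t\<bar> = - (w j - t)" using tK[OF j] by simp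
    ultimately show "(1 - c j) * (w j - t) \<le> - (\<epsilon> * \<bar>w j - t\<bar>)"
      by (metis minus_mult_right le_minus_iff)
  next
    fix j assume j: "j \<in> I - K"
    hence "\<epsilon> * \<bar>w j - t\<bar> \<le> c j * \<bar>w j - t\<bar>"
      using c(1)[of j] by (intro mult_right_mono) auto
    thus "- c j * (w j - t) \<le> - (\<epsilon> * \<bar>w j - t\<bar>)"
      using tI[OF j] by simp
  qed
  also have "\<dots> = - (\<epsilon> * d)"
    unfolding split[symmetric] d_def by (simp add: sum_negf sum_distrib_left)
  finally have 1: "(\<Sum>j\<in>K. w j) \<le> (\<Sum>j\<in>I. c j * w j) - \<epsilon> * d" by simp
  have 3: "\<bar>w i - t\<bar> \<le> d"
    unfolding d_def using fin i by (intro member_le_sum[where f="\<lambda>j. \<bar>w j - t\<bar>"]) auto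
  \<comment> \<open>Distances to \<open>w i\<close> are compared with distances to \<open>t\<close>,
    using that \<open>\<bar>w i - t\<bar>\<close> is one of the terms of \<open>d\<close>. The
    factor \<open>card I + 1\<close> lost here is the denominator of \<open>\<eta>\<close>.\<close>
  have "(\<Sum>j\<in>K. \<bar>w j - w i\<bar>) \<le> (\<Sum>j\<in>I. \<bar>w j - w i\<bar>)"
    using K(1) fin by (intro sum_mono2) auto
  also have "\<dots> \<le> (\<Sum>j\<in>I. \<bar>w j - t\<bar> + \<bar>w i - t\<bar>)" by (intro sum_mono) auto
  also have "\<dots> = d + real (card I) * \<bar>w i - t\<bar>" by (simp add: sum.distrib d_def)
  also have "\<dots> \<le> d + real (card I) * d"
    by (intro add_left_mono mult_left_mono 3) auto
  finally have 2: "(\<Sum>j\<in>K. \<bar>w j - w i\<bar>) \<le> (real (card I) + 1) * d"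
    by (simp add: algebra_simps)
  have "\<eta> \<ge> 0" using \<eta> \<open>\<epsilon> > 0\<close> by simp
  have "(\<Sum>j\<in>K. w j + \<eta> * \<bar>w j - w i\<bar>) = (\<Sum>j\<in>K. w j) + \<eta> * (\<Sum>j\<in>K. \<bar>w j - w i\<bar>)"
    by (simp add: sum.distrib sum_distrib_left)
  also have "\<dots> \<le> (\<Sum>j\<in>I. c j * w j) - \<epsilon> * d + \<eta> * ((real (card I) + 1) * d)"
    by (intro add_mono 1 mult_left_mono 2 \<open>\<eta> \<ge> 0\<close>)
  also have "\<eta> * ((real (card I) + 1) * d) = \<epsilon> * d"
    unfolding \<eta> by (simp add: field_simps)
  finally show ?thesis using K(1,2) by auto
qed

text \<open>Replacing every \<open>x j\<close> by the largest value gives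
  \<open>x i powr (sum a I)\<close>, and a power with exponent at least 1 decreases a number in
  [0, 1]. This is how condition (iv) enters.\<close>

lemma prod_powr_le_Max:
  fixes x a :: "'a \<Rightarrow> real"
  assumes "finite I" and i: "i \<in> I" "\<And>j. j \<in> I \<Longrightarrow> x j \<le> x i" "x i \<le> 1"
    and x: "\<And>j. j \<in> I \<Longrightarrow> 0 \<le> x j" and a: "\<And>j. j \<in> I \<Longrightarrow> 0 \<le> a j" "1 \<le> sum a I"
  shows "(\<Prod>j\<in>I. x j powr a j) \<le> x i"
proof (cases "x i = 0")
  case True
  hence "x i powr a i = 0" by simp
  thus ?thesis using True assms(1) i(1) by (metis order_refl prod_zero)
next
  case False
  hence "x i > 0" using x i by force
  have "(\<Prod>j\<in>I. x j powr a j) \<le> (\<Prod>j\<in>I. x i powr a j)"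
    using i x a by (intro prod_mono) (auto intro: powr_mono2)
  also have "\<dots> = x i powr (sum a I)"
    using False assms(1) by (simp add: powr_sum)
  also have "\<dots> \<le> x i powr 1"
    using \<open>x i > 0\<close> i(3) a(2) powr_mono'[of 1 "sum a I" "x i"] by simp
  finally show ?thesis using \<open>x i > 0\<close> by simp
qed

lemma nn_integral_count_space_geometric:
  fixes r :: int
  assumes "0 < q" "q < (1::real)"
  shows "(\<integral>\<^sup>+ n. ennreal (q powr \<bar>real_of_int (n - r)\<bar>) \<partial>count_space UNIV) \<le> ennreal (2 / (1 - q))"
proof -
  let ?f = "\<lambda>n. ennreal (q powr \<bar>real_of_int (n - r)\<bar>)"
  have sums: "(\<lambda>n. q ^ n) sums (1 / (1 - q))" using assms by (intro geometric_sums) auto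
  have geo: "(\<integral>\<^sup>+ k. ennreal (q ^ k) \<partial>count_space (UNIV::nat set)) = ennreal (1 / (1 - q))"
    using assms sums by (simp add: nn_integral_count_space_nat suminf_ennreal2 sums_iff)
  have "(\<integral>\<^sup>+ n. ?f n \<partial>count_space {r..}) = (\<integral>\<^sup>+ k. ?f (r + int k) \<partial>count_space UNIV)"
    by (intro nn_integral_bij_count_space[symmetric] bij_betwI[where g="\<lambda>n. nat (n - r)"]) auto
  also have "\<dots> = ennreal (1 / (1 - q))"
    using assms geo by (simp add: powr_realpow)
  finally have 1: "(\<integral>\<^sup>+ n. ?f n \<partial>count_space {r..}) = ennreal (1 / (1 - q))" .
  have "(\<integral>\<^sup>+ n. ?f n \<partial>count_space {..r}) = (\<integral>\<^sup>+ k. ?f (r - int k) \<partial>count_space UNIV)"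
    by (intro nn_integral_bij_count_space[symmetric] bij_betwI[where g="\<lambda>n. nat (r - n)"]) auto
  also have "\<dots> = ennreal (1 / (1 - q))"
    using assms geo by (simp add: powr_realpow)
  finally have 2: "(\<integral>\<^sup>+ n. ?f n \<partial>count_space {..r}) = ennreal (1 / (1 - q))" .
  \<comment> \<open>The two half-lines share the point \<open>r\<close>, so the split counts that
    term twice and yields only an upper bound.\<close>
  have "(\<integral>\<^sup>+ n. ?f n \<partial>count_space UNIV) \<le>
      (\<integral>\<^sup>+ n. ?f n * indicator {r..} n + ?f n * indicator {..r} n \<partial>count_space UNIV)"
    by (intro nn_integral_mono) (auto simp: indicator_def)
  also have "\<dots> = (\<integral>\<^sup>+ n. ?f n \<partial>count_space {r..}) + (\<integral>\<^sup>+ n. ?f n \<partial>count_space {..r})"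
    by (subst nn_integral_add) (auto simp: nn_integral_count_space_indicator)
  also have "\<dots> = ennreal (2 / (1 - q))"
    unfolding 1 2 using assms by (simp flip: ennreal_plus)
  finally show ?thesis .
qed

lemma ex_powr2_int_interval:
  assumes "0 < (z::real)"
  shows "\<exists>i::int. 2 powr (real_of_int i) < z \<and> z \<le> 2 powr (real_of_int i + 1)"
proof -
  \<comment> \<open>Ceiling minus one, rather than the floor, places exact powers of two at the
    right end of the interval.\<close>
  let ?i = "\<lceil>log 2 z\<rceil> - 1"
  have "real_of_int ?i < log 2 z" "log 2 z \<le> real_of_int ?i + 1" by linarith+
  hence "2 powr (real_of_int ?i) < z \<and> z \<le> 2 powr (real_of_int ?i + 1)"
    using assms less_log_iff[of 2 z "real_of_int ?i"] log_le_iff[of 2 z "real_of_int ?i + 1"] by auto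
  thus ?thesis by blast
qed

text \<open>The powers of two below \<open>z\<close> form a geometric series, at most twice its
  largest term. This is the discrete substitute for integrating the constant 1 from 0 to
  \<open>z\<close>.\<close>

lemma nn_integral_count_space_powr2_below:
  fixes z :: ennreal
  shows "(\<integral>\<^sup>+ n. ennreal (2 powr real_of_int n) * indicator {n. ennreal (2 powr real_of_int n) < z} n \<partial>count_space UNIV)
           \<le> 2 * z"
proof (cases "z = 0 \<or> z = \<infinity>")
  case True
  thus ?thesis by (auto simp: ennreal_mult_top)
next
  case False
  then obtain u where u: "z = ennreal u" "u > 0"
  proof (cases z)
    case (real r)
    hence "r \<noteq> 0" using False by auto
    thus ?thesis using real that[of r] by simp
  qed (use False in simp)
  obtain i :: int where i: "2 powr (real_of_int i) < u" "u \<le> 2 powr (real_of_int i + 1)"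
    using ex_powr2_int_interval[OF u(2)] by blast
  have le: "n \<le> i" if "2 powr (real_of_int n) < u" for n :: int
  proof -
    have "2 powr (real_of_int n) < 2 powr (real_of_int i + 1)" using that i by linarith
    hence "real_of_int n < real_of_int i + 1" by (simp add: powr_less_cancel_iff)
    thus ?thesis by linarith
  qed
  have sums: "(\<lambda>n. (1/2) ^ n) sums (1 / (1 - (1/2::real)))" by (intro geometric_sums) auto
  hence geo: "(\<integral>\<^sup>+ k. ennreal ((1/2) ^ k) \<partial>count_space (UNIV::nat set)) = 2"
    by (simp add: nn_integral_count_space_nat suminf_ennreal2 sums_iff)
  have "(\<integral>\<^sup>+ n. ennreal (2 powr real_of_int n) * indicator {n. ennreal (2 powr real_of_int n) < z} n \<partial>count_space UNIV)
     \<le> (\<integral>\<^sup>+ n. ennreal (2 powr real_of_int n) * indicator {..i} n \<partial>count_space UNIV)"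
    using le u by (intro nn_integral_mono) (auto simp: indicator_def ennreal_less_iff)
  also have "\<dots> = (\<integral>\<^sup>+ n. ennreal (2 powr real_of_int n) \<partial>count_space {..i})"
    by (simp add: nn_integral_count_space_indicator)
  also have "\<dots> = (\<integral>\<^sup>+ k. ennreal (2 powr (i - int k)) \<partial>count_space UNIV)"
    by (intro nn_integral_bij_count_space[symmetric] bij_betwI[where g="\<lambda>n. nat (i - n)"]) auto
  also have "\<dots> = (\<integral>\<^sup>+ k. ennreal (2 powr i) * ennreal ((1/2) ^ k) \<partial>count_space (UNIV::nat set))"
    by (intro nn_integral_cong) (simp add: powr_diff powr_realpow power_one_over flip: ennreal_mult'')
  also have "\<dots> = ennreal (2 powr i) * 2"
    by (subst nn_integral_cmult) (auto simp: geo)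
  also have "\<dots> \<le> z * 2"
    using i u by (intro mult_right_mono) (auto simp: ennreal_leI)
  finally show ?thesis by (simp add: mult.commute)
qed

section \<open>Dyadic profiles of weighted functions\<close>

text \<open>\<open>\<tau> n\<close> is the decreasing rearrangement of \<open>G\<close> at
  \<open>2 powr n\<close>. The last bound is the dyadic form of the fact that a function and its
  rearrangement have the same integral.\<close>

lemma ex_dyadic_rearrangement:
  fixes G :: "'a \<Rightarrow> real"
  assumes [measurable]: "G \<in> borel_measurable M"
    and int: "(\<integral>\<^sup>+ y. ennreal (G y) \<partial>M) \<le> 1"
  shows "\<exists>\<tau> :: int \<Rightarrow> real. antimono \<tau> \<and> (\<forall>n. 0 \<le> \<tau> n) \<and>
           (\<forall>n. emeasure M {y\<in>space M. \<tau> n < G y} \<le> ennreal (2 powr n)) \<and>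
           (\<integral>\<^sup>+ n. ennreal (2 powr real_of_int n) * ennreal (\<tau> n) \<partial>count_space UNIV) \<le> 8"
proof -
  define A where "A u = emeasure M {y\<in>space M. u < G y}" for u :: real
  have A_mono: "A u' \<le> A u" if "u \<le> u'" for u u'
    unfolding A_def using that by (intro emeasure_mono) auto
  have markov: "ennreal u * A u \<le> 1" if "u \<ge> 0" for u
  proof -
    have "ennreal u * A u = (\<integral>\<^sup>+ y. ennreal u * indicator {y\<in>space M. u < G y} y \<partial>M)"
      unfolding A_def by (simp add: nn_integral_cmult_indicator)
    also have "\<dots> \<le> (\<integral>\<^sup>+ y. ennreal (G y) \<partial>M)"
      by (intro nn_integral_mono) (auto simp: indicator_def intro: ennreal_leI)
    finally show ?thesis using int by simp
  qed
  define S where "S n = {u. 0 \<le> u \<and> A u \<le> ennreal (2 powr real_of_int n)}" for n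
  define \<tau> where "\<tau> n = Inf (S n)" for n
  have bdd: "bdd_below (S n)" for n
    by (rule bdd_belowI[of _ 0]) (auto simp: S_def)
  \<comment> \<open>Markov's inequality at height \<open>2 powr - n\<close> puts this height into
    \<open>S n\<close>.\<close>
  have ne: "S n \<noteq> {}" for n
  proof -
    have "A (2 powr - n) = ennreal (2 powr n) * (ennreal (2 powr - n) * A (2 powr - n))"
      by (simp add: mult.assoc[symmetric] ennreal_mult[symmetric] powr_add[symmetric])
    also have "\<dots> \<le> ennreal (2 powr n) * 1"
      by (intro mult_left_mono markov) auto
    finally have "2 powr - n \<in> S n" by (simp add: S_def)
    thus ?thesis by blast
  qed
  have \<tau>_nonneg: "0 \<le> \<tau> n" for n
    unfolding \<tau>_def using ne by (intro cInf_greatest) (auto simp: S_def)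
  have "antimono \<tau>"
  proof (rule antimonoI)
    fix n n' :: int assume "n \<le> n'"
    hence "ennreal (2 powr n) \<le> ennreal (2 powr n')" by (intro ennreal_leI) auto
    hence "S n \<subseteq> S n'" unfolding S_def by (blast intro: order_trans)
    thus "\<tau> n' \<le> \<tau> n" unfolding \<tau>_def by (intro cInf_superset_mono ne bdd)
  qed
  \<comment> \<open>The infimum is attained: the superlevel set at \<open>\<tau> n\<close> is the
    increasing union of those at slightly larger heights, and the measure is continuous from
    below.\<close>
  moreover have "A (\<tau> n) \<le> ennreal (2 powr n)" for n
  proof -
    let ?B = "\<lambda>k. {y\<in>space M. \<tau> n + inverse (real (Suc k)) < G y}"
    have "{y\<in>space M. \<tau> n < G y} = (\<Union>k. ?B k)"
    proof safe
      fix y assume "y \<in> space M" "\<tau> n < G y"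
      moreover from this obtain k where "inverse (real (Suc k)) < G y - \<tau> n"
        using reals_Archimedean[of "G y - \<tau> n"] by auto
      ultimately show "y \<in> (\<Union>k. ?B k)" by (auto simp: algebra_simps)
    next
      fix y k assume "\<tau> n + inverse (real (Suc k)) < G y"
      moreover have "inverse (real (Suc k)) > 0" by simp
      ultimately show "\<tau> n < G y" by linarith
    qed
    moreover have "incseq ?B"
    proof (intro incseq_SucI subsetI)
      fix k y assume y: "y \<in> ?B k"
      have "inverse (real (Suc (Suc k))) \<le> inverse (real (Suc k))"
        by (intro le_imp_inverse_le) auto
      hence "\<tau> n + inverse (real (Suc (Suc k))) < G y" using y by (simp only: mem_Collect_eq) linarith
      thus "y \<in> ?B (Suc k)" using y by simp
    qed
    ultimately have "A (\<tau> n) = (SUP k. A (\<tau> n + inverse (real (Suc k))))"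
      unfolding A_def by (subst SUP_emeasure_incseq) auto
    also have "\<dots> \<le> ennreal (2 powr n)"
    proof (rule SUP_least)
      fix k
      have "Inf (S n) < \<tau> n + inverse (real (Suc k))" by (simp add: \<tau>_def)
      then obtain u where "u \<in> S n" "u < \<tau> n + inverse (real (Suc k))"
        using cInf_lessD[OF ne] by blast
      thus "A (\<tau> n + inverse (real (Suc k))) \<le> ennreal (2 powr n)"
        using A_mono[of u "\<tau> n + inverse (real (Suc k))"] by (auto simp: S_def)
    qed
    finally show ?thesis .
  qed
  moreover have "(\<integral>\<^sup>+ n. ennreal (2 powr real_of_int n) * ennreal (\<tau> n) \<partial>count_space UNIV) \<le> 8"
  proof -
    \<comment> \<open>Discrete layer cake: for fixed height \<open>2 powr i\<close>, summing over
      the scales in \<open>?L i\<close> recovers the measure \<open>A (2 powr i)\<close>; summing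
      over \<open>i\<close> then recovers \<open>G\<close>. Rounding \<open>\<tau> n\<close> up to a
      power of two and the two geometric sums cost a factor 2 each, whence 8.\<close>
    let ?L = "\<lambda>i. {n. ennreal (2 powr real_of_int n) < A (2 powr real_of_int i)}"
    have le: "ennreal (\<tau> n) \<le> (\<integral>\<^sup>+ i. 2 * ennreal (2 powr real_of_int i) * indicator (?L i) n \<partial>count_space UNIV)"
      for n
    proof (cases "\<tau> n = 0")
      case False
      hence "\<tau> n > 0" using \<tau>_nonneg[of n] by simp
      then obtain i :: int where i: "2 powr real_of_int i < \<tau> n" "\<tau> n \<le> 2 powr (real_of_int i + 1)"
        using ex_powr2_int_interval by blast
      have "n \<in> ?L i"
      proof (rule ccontr)
        assume "n \<notin> ?L i"
        hence "2 powr real_of_int i \<in> S n" by (auto simp: S_def)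
        hence "\<tau> n \<le> 2 powr real_of_int i" unfolding \<tau>_def by (intro cInf_lower bdd)
        thus False using i by simp
      qed
      have "ennreal (\<tau> n) \<le> ennreal (2 powr (real_of_int i + 1))" by (intro ennreal_leI i)
      also have "\<dots> = 2 * ennreal (2 powr real_of_int i) * indicator (?L i) n"
        using \<open>n \<in> ?L i\<close> by (simp add: powr_add ennreal_mult' mult.commute)
      also have "\<dots> \<le> (\<integral>\<^sup>+ i. 2 * ennreal (2 powr real_of_int i) * indicator (?L i) n \<partial>count_space UNIV)"
        by (rule nn_integral_ge_point) auto
      finally show ?thesis .
    qed auto
    have "(\<integral>\<^sup>+ n. ennreal (2 powr real_of_int n) * ennreal (\<tau> n) \<partial>count_space UNIV)
        \<le> (\<integral>\<^sup>+ n. ennreal (2 powr real_of_int n) *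
              (\<integral>\<^sup>+ i. 2 * ennreal (2 powr real_of_int i) * indicator (?L i) n \<partial>count_space UNIV) \<partial>count_space UNIV)"
      by (intro nn_integral_mono mult_left_mono le) auto
    also have "\<dots> = (\<integral>\<^sup>+ n. \<integral>\<^sup>+ i. 2 * ennreal (2 powr real_of_int i) *
          (ennreal (2 powr real_of_int n) * indicator (?L i) n) \<partial>count_space UNIV \<partial>count_space UNIV)"
      by (subst nn_integral_cmult[symmetric]) (auto simp: mult_ac)
    also have "\<dots> = (\<integral>\<^sup>+ i. \<integral>\<^sup>+ n. 2 * ennreal (2 powr real_of_int i) *
          (ennreal (2 powr real_of_int n) * indicator (?L i) n) \<partial>count_space UNIV \<partial>count_space UNIV)"
      by (intro nn_integral_count_space_nn_integral) auto
    also have "\<dots> = (\<integral>\<^sup>+ i. 2 * ennreal (2 powr real_of_int i) *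
         (\<integral>\<^sup>+ n. ennreal (2 powr real_of_int n) * indicator (?L i) n \<partial>count_space UNIV) \<partial>count_space UNIV)"
      by (subst nn_integral_cmult) auto
    also have "\<dots> \<le> (\<integral>\<^sup>+ i. 2 * ennreal (2 powr real_of_int i) * (2 * A (2 powr real_of_int i)) \<partial>count_space UNIV)"
      by (intro nn_integral_mono mult_left_mono nn_integral_count_space_powr2_below) auto
    also have "\<dots> = (\<integral>\<^sup>+ i. \<integral>\<^sup>+ y. 4 * ennreal (2 powr real_of_int i) *
          indicator {y\<in>space M. 2 powr real_of_int i < G y} y \<partial>M \<partial>count_space UNIV)"
      by (subst nn_integral_cmult_indicator) (auto simp: A_def mult_ac)
    also have "\<dots> = (\<integral>\<^sup>+ y. \<integral>\<^sup>+ i. 4 * ennreal (2 powr real_of_int i) *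
          indicator {y\<in>space M. 2 powr real_of_int i < G y} y \<partial>count_space UNIV \<partial>M)"
      by (intro nn_integral_count_space_nn_integral[symmetric]) auto
    also have "\<dots> = (\<integral>\<^sup>+ y. 4 * (\<integral>\<^sup>+ i. ennreal (2 powr real_of_int i) *
          indicator {i. ennreal (2 powr real_of_int i) < ennreal (G y)} i \<partial>count_space UNIV) \<partial>M)"
      by (subst nn_integral_cmult[symmetric])
         (auto intro!: nn_integral_cong simp: indicator_def ennreal_less_iff mult_ac)
    also have "\<dots> \<le> (\<integral>\<^sup>+ y. 4 * (2 * ennreal (G y)) \<partial>M)"
      by (intro nn_integral_mono mult_left_mono nn_integral_count_space_powr2_below) auto
    also have "\<dots> = 8 * (\<integral>\<^sup>+ y. ennreal (G y) \<partial>M)"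
      by (subst nn_integral_cmult[symmetric]) (auto simp: mult.assoc[symmetric])
    also have "\<dots> \<le> 8 * 1" by (intro mult_left_mono int) auto
    finally show ?thesis by simp
  qed
  ultimately show ?thesis using \<tau>_nonneg unfolding A_def by blast
qed

text \<open>The bound says that \<open>f\<close> lies in the Lorentz space with exponents \<open>1 / c\<close> and \<open>1 / a\<close>:
  with \<open>g\<close> the weighted function and \<open>g*\<close> its rearrangement, the set where \<open>f\<close> exceeds
  \<open>2 powr (- n * (c - a)) * g* (2 powr n)\<close> is covered by a ball of volume comparable to \<open>2 powr n\<close>
  (outside of which the weight is under control) and a superlevel set of \<open>g\<close>.\<close>

lemma ex_weak_type_profile:
  fixes a c :: real
  assumes "0 < a" "a \<le> c"
  shows "\<exists>D>0. \<forall>f :: 'a::euclidean_space \<Rightarrow> real.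
    f \<in> borel_measurable borel \<longrightarrow> (\<forall>y. 0 \<le> f y) \<longrightarrow>
    (\<integral>\<^sup>+ y. ennreal ((norm y powr (DIM('a) * (c - a)) * f y) powr (1 / a)) \<partial>lborel) \<le> 1 \<longrightarrow>
    (\<exists>(E :: int \<Rightarrow> 'a set) (x :: int \<Rightarrow> real). (\<forall>n. E n \<in> sets borel \<and> emeasure lborel (E n) \<le> ennreal (D * 2 powr n)) \<and>
       (\<forall>n. 0 \<le> x n) \<and> (\<integral>\<^sup>+ n. ennreal (x n) \<partial>count_space UNIV) \<le> 1 \<and>
       (AE y in lborel. 0 < f y \<longrightarrow> (\<exists>n. y \<in> E n \<and> f y \<le> D * x n powr a * 2 powr (- (c * n)))))"
proof -
  let ?k = "real DIM('a)"
  \<comment> \<open>The summands of \<open>W\<close> belong to the ball and to the superlevel set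
    that cover \<open>E n\<close>. The second entry of the maximum in \<open>D\<close> is the
    constant of \<open>t_eq\<close>: \<open>8 powr a\<close> from normalizing \<open>x\<close>,
    \<open>2 powr c\<close> from an index shift.\<close>
  define W where "W = unit_ball_vol ?k + 1"
  define D where "D = max W (8 powr a * 2 powr c)"
  have "W > 0" by (auto simp: W_def intro: add_nonneg_pos)
  hence "D > 0" by (simp add: D_def)
  moreover have "\<exists>(E :: int \<Rightarrow> 'a set) (x :: int \<Rightarrow> real). (\<forall>n. E n \<in> sets borel \<and> emeasure lborel (E n) \<le> ennreal (D * 2 powr n)) \<and>
       (\<forall>n. 0 \<le> x n) \<and> (\<integral>\<^sup>+ n. ennreal (x n) \<partial>count_space UNIV) \<le> 1 \<and>
       (AE y in lborel. 0 < f y \<longrightarrow> (\<exists>n. y \<in> E n \<and> f y \<le> D * x n powr a * 2 powr (- (c * n))))"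
    if [measurable]: "f \<in> borel_measurable borel" and f: "\<And>y. 0 \<le> f y"
      and int: "(\<integral>\<^sup>+ y. ennreal ((norm y powr (?k * (c - a)) * f y) powr (1 / a)) \<partial>lborel) \<le> 1"
    for f :: "'a \<Rightarrow> real"
  proof -
    define G where "G y = (norm y powr (?k * (c - a)) * f y) powr (1 / a)" for y
    have [measurable]: "G \<in> borel_measurable lborel" unfolding G_def by measurable
    obtain \<tau> :: "int \<Rightarrow> real" where "antimono \<tau>" and \<tau>_nonneg: "\<And>n. 0 \<le> \<tau> n"
      and level: "\<And>n. emeasure lborel {y. \<tau> n < G y} \<le> ennreal (2 powr n)"
      and sum\<tau>: "(\<integral>\<^sup>+ n. ennreal (2 powr real_of_int n) * ennreal (\<tau> n) \<partial>count_space UNIV) \<le> 8"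
      using ex_dyadic_rearrangement[of G lborel] int unfolding G_def by auto
    \<comment> \<open>\<open>\<tau> n powr a\<close> is the rearrangement of the weighted function
      at \<open>2 powr n\<close>. It is divided by the value of the weight at radius
      \<open>2 powr (n / ?k)\<close>, the radius of a ball of volume comparable to
      \<open>2 powr n\<close>.\<close>
    define t where "t n = 2 powr (- (n * (c - a))) * \<tau> n powr a" for n :: int
    define E where "E n = {y. t n < f y}" for n
    \<comment> \<open>The index is shifted because at a point \<open>y\<close> the first level with
      \<open>t n < f y\<close> is used, where \<open>f y\<close> is bounded by
      \<open>t (n - 1)\<close>. Dividing by 8 makes the sum at most 1.\<close>
    define x where "x n = 2 powr (n - 1) * \<tau> (n - 1) / 8" for n :: int
    have [measurable]: "E n \<in> sets borel" for n unfolding E_def by measurable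
    have t_antimono: "t n' \<le> t n" if "n \<le> n'" for n n'
      unfolding t_def using that antimonoD[OF \<open>antimono \<tau>\<close> that] \<tau>_nonneg assms
      by (intro mult_mono powr_mono2) (auto intro: mult_right_mono)
    have measE: "emeasure lborel (E n) \<le> ennreal (W * 2 powr n)" for n
    proof -
      define R where "R = 2 powr (n / ?k)"
      have R: "R > 0" "R ^ DIM('a) = 2 powr n"
        by (auto simp: R_def powr_power)
      have "E n \<subseteq> cball 0 R \<union> {y. \<tau> n < G y}"
      proof
        fix y assume "y \<in> E n"
        hence y: "t n < f y" by (simp add: E_def)
        show "y \<in> cball 0 R \<union> {y. \<tau> n < G y}"
        proof (cases "norm y \<le> R")
          case False
          have tn: "t n \<ge> 0" by (simp add: t_def)
          have "2 powr (n * (c - a)) = R powr (?k * (c - a))"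
            by (simp add: R_def powr_powr)
          also have "\<dots> \<le> norm y powr (?k * (c - a))"
            using False R assms by (intro powr_mono2) auto
          finally have w: "2 powr (n * (c - a)) \<le> norm y powr (?k * (c - a))" .
          have "\<tau> n powr a = 2 powr (n * (c - a)) * t n"
            by (simp add: t_def powr_add[symmetric] mult.assoc[symmetric])
          also have "\<dots> < 2 powr (n * (c - a)) * f y" using y by simp
          also have "\<dots> \<le> norm y powr (?k * (c - a)) * f y" using w f by (intro mult_right_mono) auto
          finally have "(\<tau> n powr a) powr (1 / a) < G y"
            unfolding G_def using assms by (intro powr_less_mono2) auto
          thus ?thesis using \<tau>_nonneg[of n] assms by (simp add: powr_powr)
        qed auto
      qed
      hence "emeasure lborel (E n) \<le> emeasure lborel (cball 0 R \<union> {y. \<tau> n < G y})"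
        by (intro emeasure_mono) auto
      also have "\<dots> \<le> emeasure lborel (cball (0::'a) R) + emeasure lborel {y. \<tau> n < G y}"
        by (intro emeasure_subadditive) auto
      also have "\<dots> \<le> ennreal (unit_ball_vol ?k * 2 powr n) + ennreal (2 powr n)"
        using R by (intro add_mono level) (simp add: emeasure_cball)
      also have "\<dots> = ennreal (W * 2 powr n)"
        by (simp add: W_def algebra_simps flip: ennreal_plus)
      finally show ?thesis .
    qed
    have \<tau>_le: "\<tau> n \<le> 8 * 2 powr (- n)" for n
    proof -
      have "ennreal (2 powr n * \<tau> n) = ennreal (2 powr n) * ennreal (\<tau> n)"
        by (simp add: ennreal_mult')
      also have "\<dots> \<le> 8"
        using nn_integral_ge_point[of n UNIV "\<lambda>n. ennreal (2 powr real_of_int n) * ennreal (\<tau> n)"] sum\<tau>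
        by (meson UNIV_I order_trans)
      finally have "2 powr n * \<tau> n \<le> 8"
        by (simp add: ennreal_le_iff[of 8, simplified])
      thus ?thesis by (simp add: powr_minus field_simps)
    qed
    have "(\<integral>\<^sup>+ n. ennreal (x n) \<partial>count_space UNIV) =
        (\<integral>\<^sup>+ n. ennreal (2 powr real_of_int n * \<tau> n / 8) \<partial>count_space UNIV)"
      by (subst nn_integral_bij_count_space[symmetric, of "\<lambda>n. n + 1" UNIV UNIV])
         (auto simp: x_def intro: bij_betwI[where g="\<lambda>n. n - 1"])
    also have "\<dots> = (\<integral>\<^sup>+ n. ennreal (1 / 8) * (ennreal (2 powr real_of_int n) * ennreal (\<tau> n)) \<partial>count_space UNIV)"
      using \<tau>_nonneg by (intro nn_integral_cong) (simp flip: ennreal_mult)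
    also have "\<dots> = ennreal (1 / 8) * (\<integral>\<^sup>+ n. ennreal (2 powr real_of_int n) * ennreal (\<tau> n) \<partial>count_space UNIV)"
      by (subst nn_integral_cmult) auto
    also have "\<dots> \<le> ennreal (1 / 8) * ennreal 8"
      using sum\<tau> by (intro mult_left_mono) auto
    also have "\<dots> = 1" by (subst ennreal_mult[symmetric]) auto
    finally have sumx: "(\<integral>\<^sup>+ n. ennreal (x n) \<partial>count_space UNIV) \<le> 1" .
    have x_nonneg: "0 \<le> x n" for n using \<tau>_nonneg by (simp add: x_def)
    have t_eq: "t (n - 1) = 8 powr a * 2 powr c * x n powr a * 2 powr (- (c * n))" for n
    proof -
      have "\<tau> (n - 1) = 8 * x n * 2 powr (- (n - 1))"
        by (simp add: x_def powr_minus powr_diff field_simps)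
      hence "\<tau> (n - 1) powr a = 8 powr a * x n powr a * 2 powr (- (n - 1) * a)"
        using x_nonneg[of n] by (simp add: powr_mult powr_powr)
      hence "t (n - 1) = 8 powr a * x n powr a * 2 powr (- ((n - 1) * (c - a)) + (- (n - 1) * a))"
        by (simp add: t_def flip: powr_add)
      also have "- ((n - 1) * (c - a)) + (- (n - 1) * a) = c + (- (c * n))"
        by (simp add: algebra_simps)
      finally show ?thesis by (simp only: powr_add mult_ac)
    qed
    \<comment> \<open>On \<open>Z\<close> the function exceeds every \<open>t n\<close>, so no first
      level exists. The measures of the sets \<open>E n\<close> tend to 0 as \<open>n\<close>
      decreases, so \<open>Z\<close> is null.\<close>
    define Z where "Z = (\<Inter>n. E n)"
    have [measurable]: "Z \<in> sets borel" unfolding Z_def by measurable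
    have "emeasure lborel Z = 0"
    proof (rule ccontr)
      assume nz: "emeasure lborel Z \<noteq> 0"
      have le: "emeasure lborel Z \<le> ennreal (W * 2 powr n)" for n :: int
        by (rule order_trans[OF emeasure_mono measE]) (auto simp: Z_def)
      then obtain z where z: "emeasure lborel Z = ennreal z" "z \<ge> 0"
        using le[of 0] by (cases "emeasure lborel Z") (auto simp: top_unique)
      with nz have "z > 0" by (cases "z = 0") auto
      then obtain n :: int where "2 powr real_of_int n < z / W"
        using ex_powr2_int_interval[of "z / W"] \<open>W > 0\<close> by auto
      hence "W * 2 powr real_of_int n < z" using \<open>W > 0\<close> by (simp add: field_simps)
      thus False using le[of n] z \<open>z > 0\<close> by (simp add: ennreal_le_iff2)
    qed
    hence "AE y in lborel. y \<notin> Z" by (intro AE_not_in) (auto simp: null_sets_def)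
    moreover have "\<exists>n. y \<in> E n \<and> f y \<le> t (n - 1)" if "y \<notin> Z" "0 < f y" for y
    proof -
      obtain M where M: "\<not> t M < f y" using \<open>y \<notin> Z\<close> by (auto simp: Z_def E_def)
      \<comment> \<open>By \<open>\<tau>_le\<close>, \<open>t n\<close> is at most
        \<open>8 powr a * 2 powr (- (c * n))\<close>, which reaches the value \<open>f y\<close> at
        \<open>n = - b\<close>; so \<open>t n < f y\<close> beyond \<open>- b\<close>. The maximum
        with \<open>M\<close> makes \<open>n0 - M\<close> a natural number, so a least index after
        \<open>M\<close> can be taken.\<close>
      define b where "b = log 2 (f y / 8 powr a) / c"
      define n0 where "n0 = max M (\<lceil>- b\<rceil> + 1)"
      have "- b < n0" unfolding n0_def by linarith
      hence "- (c * n0) < log 2 (f y / 8 powr a)"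
        using assms by (simp add: b_def field_simps)
      hence "2 powr (- (c * n0)) < f y / 8 powr a"
        using \<open>0 < f y\<close> by (subst (asm) less_log_iff) auto
      hence *: "8 powr a * 2 powr (- (c * n0)) < f y" by (simp add: field_simps)
      have "t n0 \<le> 2 powr (- (n0 * (c - a))) * (8 * 2 powr (- n0)) powr a"
        unfolding t_def using \<tau>_le[of n0] \<tau>_nonneg assms by (intro mult_left_mono powr_mono2) auto
      also have "\<dots> = 8 powr a * 2 powr (- (n0 * (c - a)) + (- n0 * a))"
        by (simp add: powr_mult powr_powr flip: powr_add)
      also have "- (n0 * (c - a)) + (- n0 * a) = - (c * n0)" by (simp add: algebra_simps)
      finally have "t n0 < f y" using * by simp
      hence ex: "t (M + int (nat (n0 - M))) < f y" by (simp add: n0_def)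
      define m where "m = (LEAST m. t (M + int m) < f y)"
      have m: "t (M + int m) < f y" unfolding m_def by (rule LeastI[of _ "nat (n0 - M)"]) (rule ex)
      hence "m \<noteq> 0" using M by (cases m) auto
      hence "\<not> t (M + int (m - 1)) < f y"
        using not_less_Least[of "m - 1" "\<lambda>m. t (M + int m) < f y", folded m_def] by simp
      moreover have "M + int (m - 1) = M + int m - 1" using \<open>m \<noteq> 0\<close> by simp
      ultimately have "f y \<le> t (M + int m - 1)" by (simp only: not_less)
      thus ?thesis using m by (intro exI[of _ "M + int m"]) (auto simp: E_def)
    qed
    moreover have "t (n - 1) \<le> D * x n powr a * 2 powr (- (c * n))" for n
      unfolding t_eq by (intro mult_right_mono) (auto simp: D_def)
    ultimately have "AE y in lborel. 0 < f y \<longrightarrow> (\<exists>n. y \<in> E n \<and> f y \<le> D * x n powr a * 2 powr (- (c * n)))"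
      by (auto elim!: eventually_mono) (meson order_trans)
    moreover have "emeasure lborel (E n) \<le> ennreal (D * 2 powr n)" for n
      by (rule order_trans[OF measE]) (auto simp: D_def intro!: ennreal_leI mult_right_mono)
    ultimately show ?thesis using sumx x_nonneg
      by (intro exI[of _ E] exI[of _ x]) auto
  qed
  ultimately show ?thesis by blast
qed

section \<open>Linear changes of variables\<close>

text \<open>Covers translations (\<open>c = 1\<close>) and point reflections (\<open>c = -1\<close>)
  at once; the Jacobian factor \<open>\<bar>c\<bar> ^ DIM('a)\<close> is 1.\<close>

lemma nn_integral_lborel_isometry:
  fixes h :: "'a::euclidean_space \<Rightarrow> ennreal"
  assumes [measurable]: "h \<in> borel_measurable borel" and "\<bar>c\<bar> = 1"
  shows "(\<integral>\<^sup>+ x. h (t + c *\<^sub>R x) \<partial>lborel) = (\<integral>\<^sup>+ x. h x \<partial>lborel)"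
proof -
  have "c \<noteq> 0" using assms(2) by auto
  have "(\<integral>\<^sup>+ x. h x \<partial>lborel) = (\<integral>\<^sup>+ x. h x \<partial>density (distr lborel borel (\<lambda>x. t + c *\<^sub>R x)) (\<lambda>_. ennreal (\<bar>c\<bar> ^ DIM('a))))"
    using lborel_affine[OF \<open>c \<noteq> 0\<close>, of t] by simp
  also have "\<dots> = (\<integral>\<^sup>+ x. h x \<partial>distr lborel borel (\<lambda>x. t + c *\<^sub>R x))"
    using assms(2) by (simp add: density_1)
  also have "\<dots> = (\<integral>\<^sup>+ x. h (t + c *\<^sub>R x) \<partial>lborel)"
    by (intro nn_integral_distr) auto
  finally show ?thesis ..
qed

text \<open>Uniqueness of translation-invariant integrals: both sides of the identity \<open>*\<close> below
  are the integral of \<open>h (T x + y) * indicator B y\<close> over all \<open>x\<close> and \<open>y\<close>.\<close>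

lemma nn_integral_lborel_linear_inj:
  fixes T :: "'a::euclidean_space \<Rightarrow> 'a"
  assumes "linear T" "inj T"
  shows "\<exists>C\<ge>0. \<forall>h \<in> borel_measurable borel.
           (\<integral>\<^sup>+ x. h (T x) \<partial>lborel) = ennreal C * (\<integral>\<^sup>+ x. h x \<partial>lborel)"
proof -
  interpret T: linear T by fact
  obtain S where S: "linear S" "S \<circ> T = id" "T \<circ> S = id"
    using linear_injective_isomorphism[OF assms] by (auto simp: fun_eq_iff)
  have TS: "T (S y) = y" and ST: "S (T y) = y" for y
    using S by (auto simp: fun_eq_iff)
  have [measurable]: "T \<in> borel_measurable borel"
    by (intro borel_measurable_continuous_onI linear_continuous_on linear_conv_bounded_linear[THEN iffD1] assms)
  define B where "B = ball (0::'a) 1"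
  have [measurable]: "B \<in> sets borel" by (simp add: B_def)
  have *: "(\<integral>\<^sup>+ x. h (T x) \<partial>lborel) * emeasure lborel B =
           (\<integral>\<^sup>+ x. h x \<partial>lborel) * (\<integral>\<^sup>+ x. indicator B (T x) \<partial>lborel)"
    if [measurable]: "h \<in> borel_measurable borel" for h
  proof -
    have "(\<integral>\<^sup>+ x. h (T x) \<partial>lborel) * emeasure lborel B =
        (\<integral>\<^sup>+ y. (\<integral>\<^sup>+ x. h (T x) \<partial>lborel) * indicator B y \<partial>lborel)"
      by (subst nn_integral_cmult) auto
    \<comment> \<open>Translating \<open>x\<close> by \<open>S y\<close> translates
      \<open>T x\<close> by \<open>y\<close>.\<close>
    also have "\<dots> = (\<integral>\<^sup>+ y. (\<integral>\<^sup>+ x. h (T x + y) \<partial>lborel) * indicator B y \<partial>lborel)"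
    proof (rule nn_integral_cong, rule arg_cong2[where f="(*)", OF _ refl])
      fix y
      show "(\<integral>\<^sup>+ x. h (T x) \<partial>lborel) = (\<integral>\<^sup>+ x. h (T x + y) \<partial>lborel)"
        using nn_integral_lborel_isometry[of "\<lambda>x. h (T x)" 1 "S y"]
        by (simp add: T.add TS add.commute)
    qed
    also have "\<dots> = (\<integral>\<^sup>+ y. \<integral>\<^sup>+ x. h (T x + y) * indicator B y \<partial>lborel \<partial>lborel)"
      by (subst nn_integral_multc) auto
    also have "\<dots> = (\<integral>\<^sup>+ x. \<integral>\<^sup>+ y. h (T x + y) * indicator B y \<partial>lborel \<partial>lborel)"
      by (rule lborel_pair.Fubini'[symmetric]) measurable
    also have "\<dots> = (\<integral>\<^sup>+ x. \<integral>\<^sup>+ y. h y * indicator B (y - T x) \<partial>lborel \<partial>lborel)"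
    proof (rule nn_integral_cong)
      fix x
      show "(\<integral>\<^sup>+ y. h (T x + y) * indicator B y \<partial>lborel) = (\<integral>\<^sup>+ y. h y * indicator B (y - T x) \<partial>lborel)"
        using nn_integral_lborel_isometry[of "\<lambda>y. h y * indicator B (y - T x)" 1 "T x"] by simp
    qed
    also have "\<dots> = (\<integral>\<^sup>+ y. \<integral>\<^sup>+ x. h y * indicator B (y - T x) \<partial>lborel \<partial>lborel)"
      by (rule lborel_pair.Fubini') measurable
    also have "\<dots> = (\<integral>\<^sup>+ y. h y * (\<integral>\<^sup>+ x. indicator B (y - T x) \<partial>lborel) \<partial>lborel)"
      by (subst nn_integral_cmult) auto
    \<comment> \<open>Substituting \<open>S y - x\<close> for \<open>x\<close> removes the
      dependence on \<open>y\<close>, so the double integral factors.\<close>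
    also have "\<dots> = (\<integral>\<^sup>+ y. h y * (\<integral>\<^sup>+ x. indicator B (T x) \<partial>lborel) \<partial>lborel)"
    proof (rule nn_integral_cong, rule arg_cong2[where f="(*)", OF refl])
      fix y
      show "(\<integral>\<^sup>+ x. indicator B (y - T x) \<partial>lborel) = (\<integral>\<^sup>+ x. indicator B (T x) \<partial>lborel)"
        using nn_integral_lborel_isometry[of "\<lambda>x. indicator B (T x)" "-1" "S y"]
        by (simp add: T.diff TS)
    qed
    also have "\<dots> = (\<integral>\<^sup>+ x. h x \<partial>lborel) * (\<integral>\<^sup>+ x. indicator B (T x) \<partial>lborel)"
      by (rule nn_integral_multc) auto
    finally show ?thesis .
  qed
  \<comment> \<open>The inverse \<open>S\<close> is bounded, so the preimage of the unit ball under
    \<open>T\<close> has finite volume. The constant is the ratio of this volume to that of the unit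
    ball.\<close>
  obtain K where K: "K > 0" "\<And>y. norm (S y) \<le> K * norm y"
    using linear_bounded_pos[OF S(1)] by blast
  have "(\<integral>\<^sup>+ x. indicator B (T x) \<partial>lborel) \<le> (\<integral>\<^sup>+ x. indicator (cball (0::'a) K) x \<partial>lborel)"
  proof (intro nn_integral_mono)
    fix x :: 'a
    have "norm x \<le> K" if "norm (T x) < 1"
    proof -
      have "norm x \<le> K * norm (T x)" using K(2)[of "T x"] by (simp add: ST)
      also have "\<dots> \<le> K * 1" using that K(1) by (intro mult_left_mono) auto
      finally show ?thesis by simp
    qed
    thus "indicator B (T x) \<le> (indicator (cball 0 K) x :: ennreal)"
      by (auto simp: B_def indicator_def)
  qed
  also have "\<dots> < \<infinity>" by (simp add: emeasure_cball[OF less_imp_le] K(1))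
  finally obtain b where b: "(\<integral>\<^sup>+ x. indicator B (T x) \<partial>lborel) = ennreal b" "b \<ge> 0"
    by (cases "(\<integral>\<^sup>+ x. indicator B (T x) \<partial>lborel :: ennreal)") auto
  obtain \<beta> where \<beta>: "emeasure lborel B = ennreal \<beta>" "\<beta> > 0"
    by (rule that[of "unit_ball_vol (real DIM('a))"]) (simp_all add: B_def emeasure_ball)
  have "(\<integral>\<^sup>+ x. h (T x) \<partial>lborel) = ennreal (b / \<beta>) * (\<integral>\<^sup>+ x. h x \<partial>lborel)"
    if "h \<in> borel_measurable borel" for h
  proof -
    have "(\<integral>\<^sup>+ x. h (T x) \<partial>lborel) = (\<integral>\<^sup>+ x. h (T x) \<partial>lborel) * (ennreal \<beta> * ennreal (1 / \<beta>))"
      using \<beta>(2) by (simp flip: ennreal_mult)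
    also have "\<dots> = (\<integral>\<^sup>+ x. h x \<partial>lborel) * ennreal b * ennreal (1 / \<beta>)"
      using *[OF that] by (simp add: \<beta> b mult.assoc[symmetric])
    also have "\<dots> = ennreal (b / \<beta>) * (\<integral>\<^sup>+ x. h x \<partial>lborel)"
      using b(2) \<beta>(2) ennreal_mult[of b "1 / \<beta>"] by (simp add: mult_ac)
    finally show ?thesis .
  qed
  thus ?thesis using b(2) \<beta>(2) by (intro exI[of _ "b / \<beta>"]) auto
qed

section \<open>Lebesgue measure on block vectors as a product measure\<close>

lemma borel_measurable_PiM_vec_lambda [measurable]:
  "(\<lambda>f. \<chi> i. f i) \<in> borel_measurable
     (\<Pi>\<^sub>M i\<in>(UNIV :: 'm::finite set). (lborel :: 'a::euclidean_space measure))"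
proof (subst borel_measurable_euclidean_space, intro ballI)
  fix b :: "'a ^ 'm" assume "b \<in> Basis"
  then obtain i u where b: "b = axis i u" by (auto simp: Basis_vec_def)
  have "(\<lambda>f. f i \<bullet> u) \<in> borel_measurable (\<Pi>\<^sub>M i\<in>(UNIV :: 'm set). (lborel :: 'a measure))"
    by measurable
  thus "(\<lambda>f. (\<chi> i. f i) \<bullet> b) \<in> borel_measurable (\<Pi>\<^sub>M i\<in>(UNIV :: 'm set). (lborel :: 'a measure))"
    by (simp add: b inner_axis)
qed

lemma lborel_eq_distr_PiM_vec:
  "lborel = distr (\<Pi>\<^sub>M i\<in>(UNIV :: 'm::finite set). (lborel :: 'a::euclidean_space measure)) borel (\<lambda>f. \<chi> i. f i)"
proof (rule lborel_eqI)
  let ?P = "\<Pi>\<^sub>M i\<in>(UNIV :: 'm set). (lborel :: 'a measure)"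
  interpret product_sigma_finite "\<lambda>_::'m. lborel :: 'a measure" ..
  fix l u :: "'a ^ 'm" assume "\<And>b. b \<in> Basis \<Longrightarrow> l \<bullet> b \<le> u \<bullet> b"
  hence le: "l $ i \<bullet> b \<le> u $ i \<bullet> b" if "b \<in> Basis" for i b
    using that by (metis axis_in_Basis_iff inner_axis)
  have "emeasure (distr ?P borel (\<lambda>f. \<chi> i. f i)) (box l u) =
      emeasure ?P ((\<lambda>f. \<chi> i. f i) -` box l u \<inter> space ?P)"
    by (intro emeasure_distr) auto
  also have "(\<lambda>f. \<chi> i. f i) -` box l u \<inter> space ?P = Pi\<^sub>E UNIV (\<lambda>i. box (l $ i) (u $ i))"
    by (auto simp: space_PiM mem_box Basis_vec_def inner_axis PiE_UNIV_domain Pi_iff)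
  also have "emeasure ?P \<dots> = (\<Prod>i\<in>UNIV. emeasure lborel (box (l $ i) (u $ i)))"
    by (intro emeasure_PiM) auto
  also have "\<dots> = (\<Prod>i\<in>UNIV. ennreal (\<Prod>b\<in>Basis. (u $ i - l $ i) \<bullet> b))"
    by (intro prod.cong refl emeasure_lborel_box le)
  also have "\<dots> = ennreal (\<Prod>i\<in>UNIV. \<Prod>b\<in>Basis. (u $ i - l $ i) \<bullet> b)"
    using le by (intro prod_ennreal prod_nonneg) (auto simp: inner_diff_left)
  also have "(\<Prod>i\<in>UNIV. \<Prod>b\<in>Basis. (u $ i - l $ i) \<bullet> b) = (\<Prod>i\<in>UNIV. \<Prod>b\<in>axis i ` Basis. (u - l) \<bullet> b)"
    by (subst prod.reindex) (auto simp: inj_on_def axis_eq_axis inner_axis)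
  also have "\<dots> = (\<Prod>b\<in>(\<Union>i. axis i ` Basis). (u - l) \<bullet> b)"
    by (rule prod.UNION_disjoint[symmetric]) (auto simp: axis_eq_axis)
  also have "(\<Union>i. axis i ` Basis) = (Basis :: ('a ^ 'm) set)"
    by (auto simp: Basis_vec_def)
  finally show "emeasure (distr ?P borel (\<lambda>f. \<chi> i. f i)) (box l u) = ennreal (\<Prod>b\<in>Basis. (u - l) \<bullet> b)" .
qed simp

lemma borel_measurable_vec_nth [measurable]:
  "(\<lambda>x :: 'a::euclidean_space ^ 'm. x $ i) \<in> borel_measurable borel"
  by (intro borel_measurable_continuous_onI continuous_intros)

lemma nn_integral_prod_vec_nth:
  fixes U :: "'m::finite \<Rightarrow> 'a::euclidean_space \<Rightarrow> ennreal"
  assumes [measurable]: "\<And>i. U i \<in> borel_measurable borel"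
  shows "(\<integral>\<^sup>+ y. (\<Prod>i\<in>UNIV. U i (y $ i)) \<partial>lborel) = (\<Prod>i\<in>UNIV. \<integral>\<^sup>+ y. U i y \<partial>lborel)"
proof -
  let ?P = "\<Pi>\<^sub>M i\<in>(UNIV :: 'm set). (lborel :: 'a measure)"
  interpret product_sigma_finite "\<lambda>_::'m. lborel :: 'a measure" ..
  have "(\<integral>\<^sup>+ y. (\<Prod>i\<in>UNIV. U i (y $ i)) \<partial>lborel) =
      (\<integral>\<^sup>+ y. (\<Prod>i\<in>UNIV. U i (y $ i)) \<partial>distr ?P borel (\<lambda>f. \<chi> i. f i))"
    by (subst lborel_eq_distr_PiM_vec) (rule refl)
  also have "\<dots> = (\<integral>\<^sup>+ f. (\<Prod>i\<in>UNIV. U i (f i)) \<partial>?P)"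
    by (subst nn_integral_distr) auto
  also have "\<dots> = (\<Prod>i\<in>UNIV. \<integral>\<^sup>+ y. U i y \<partial>lborel)"
    by (intro product_nn_integral_prod) auto
  finally show ?thesis .
qed

section \<open>Block products as linear coordinates\<close>

lemma block_dot_add_left: "block_dot (v + w) x = block_dot v x + block_dot w x"
  by (simp add: block_dot_def scaleR_add_left sum.distrib)

lemma block_dot_scaleR_left: "block_dot (r *\<^sub>R v) x = r *\<^sub>R block_dot v x"
  by (simp add: block_dot_def scaleR_sum_right)

lemma block_dot_axis: "block_dot (axis i 1) x = x $ i"
proof -
  have "block_dot (axis i 1) x = (\<Sum>j\<in>UNIV. if j = i then x $ j else 0)"
    unfolding block_dot_def axis_def by (intro sum.cong) auto
  thus ?thesis by simp
qed

lemma linear_block_dot: "linear (block_dot v)"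
  by (intro linearI)
     (simp_all add: block_dot_def scaleR_add_right sum.distrib scaleR_sum_right mult.commute)

lemma linear_block_dot_left: "linear (\<lambda>v. block_dot v x)"
  by (intro linearI block_dot_add_left block_dot_scaleR_left)

lemma borel_measurable_block_dot [measurable]: "block_dot v \<in> borel_measurable borel"
  by (intro borel_measurable_continuous_onI linear_continuous_on
      linear_conv_bounded_linear[THEN iffD1] linear_block_dot)

lemma block_dot_eq_0_on_span:
  assumes "\<And>w. w \<in> B \<Longrightarrow> block_dot w x = 0" "u \<in> span B"
  shows "block_dot u x = 0"
  using linear_eq_0_on_span[OF linear_block_dot_left assms] .

text \<open>If these block products of \<open>x\<close> vanish, then by linearity in the vector so
  do all others, including those with the axis vectors, which are the blocks of
  \<open>x\<close>.\<close>

lemma linear_inj_block_dots: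
  fixes v :: "'i \<Rightarrow> real ^ 'm" and \<sigma> :: "'m \<Rightarrow> 'i"
  assumes "span (v ` range \<sigma>) = UNIV"
  shows "linear (\<lambda>x :: real ^ 'k ^ 'm. \<chi> i. block_dot (v (\<sigma> i)) x)" (is "linear ?T")
    and "inj (\<lambda>x :: real ^ 'k ^ 'm. \<chi> i. block_dot (v (\<sigma> i)) x)"
proof -
  show lin: "linear ?T"
    by (intro linearI)
       (simp_all add: vec_eq_iff linear_add[OF linear_block_dot] linear_scale[OF linear_block_dot])
  show "inj ?T"
  proof (subst linear_injective_0[OF lin], safe)
    fix x :: "real ^ 'k ^ 'm" assume "?T x = 0"
    hence "block_dot (v (\<sigma> i)) x = 0" for i by (simp add: vec_eq_iff)
    hence "block_dot w x = 0" if "w \<in> v ` range \<sigma>" for w using that by auto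
    hence "block_dot w x = 0" for w using block_dot_eq_0_on_span[of "v ` range \<sigma>" x w] assms by auto
    from this[of "axis _ 1"] show "x = 0" by (simp add: block_dot_axis vec_eq_iff)
  qed
qed

text \<open>The block products with a basis serve as new coordinates, in which Tonelli's theorem
  factors the integral. The constant is a Jacobian factor, chosen before the functions
  \<open>U\<close>.\<close>

lemma nn_integral_prod_block_dot:
  fixes v :: "'i \<Rightarrow> real ^ 'm" and K :: "'i set"
  assumes span: "span (v ` K) = UNIV" and card: "card K = CARD('m)"
  shows "\<exists>C\<ge>0. \<forall>U :: 'i \<Rightarrow> real ^ 'k \<Rightarrow> ennreal. (\<forall>j\<in>K. U j \<in> borel_measurable borel) \<longrightarrow>
    (\<integral>\<^sup>+ x. (\<Prod>j\<in>K. U j (block_dot (v j) x)) \<partial>lborel) =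
      ennreal C * (\<Prod>j\<in>K. \<integral>\<^sup>+ y. U j y \<partial>lborel)"
proof -
  have "finite K" using card by (intro card_ge_0_finite) auto
  then obtain \<sigma> :: "'m \<Rightarrow> 'i" where \<sigma>: "bij_betw \<sigma> UNIV K"
    using card by (metis bij_betw_iff_card finite)
  define T :: "real ^ 'k ^ 'm \<Rightarrow> real ^ 'k ^ 'm" where "T x = (\<chi> i. block_dot (v (\<sigma> i)) x)" for x
  have "range \<sigma> = K" using \<sigma> by (simp add: bij_betw_def)
  hence "linear T" "inj T"
    unfolding T_def using linear_inj_block_dots[of v \<sigma>] span by auto
  obtain C where C: "C \<ge> 0" "\<And>h. h \<in> borel_measurable borel \<Longrightarrow>
      (\<integral>\<^sup>+ x. h (T x) \<partial>lborel) = ennreal C * (\<integral>\<^sup>+ x. h x \<partial>lborel)"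
    using nn_integral_lborel_linear_inj[OF \<open>linear T\<close> \<open>inj T\<close>] by blast
  have "(\<integral>\<^sup>+ x. (\<Prod>j\<in>K. U j (block_dot (v j) x)) \<partial>lborel) = ennreal C * (\<Prod>j\<in>K. \<integral>\<^sup>+ y. U j y \<partial>lborel)"
    if "\<forall>j\<in>K. U j \<in> borel_measurable borel" for U :: "'i \<Rightarrow> real ^ 'k \<Rightarrow> ennreal"
  proof -
    have [measurable]: "U (\<sigma> i) \<in> borel_measurable borel" for i
      using that \<sigma> by (auto simp: bij_betw_def)
    have reindex: "(\<Prod>j\<in>K. g j) = (\<Prod>i\<in>UNIV. g (\<sigma> i))" for g :: "'i \<Rightarrow> ennreal"
      using prod.reindex_bij_betw[OF \<sigma>, of g] by simp
    have "(\<integral>\<^sup>+ x. (\<Prod>j\<in>K. U j (block_dot (v j) x)) \<partial>lborel) =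
        (\<integral>\<^sup>+ x. (\<Prod>i\<in>UNIV. U (\<sigma> i) (T x $ i)) \<partial>lborel)"
      by (simp add: reindex T_def)
    also have "\<dots> = ennreal C * (\<integral>\<^sup>+ y. (\<Prod>i\<in>UNIV. U (\<sigma> i) (y $ i)) \<partial>lborel)"
      by (rule C(2)) measurable
    also have "\<dots> = ennreal C * (\<Prod>j\<in>K. \<integral>\<^sup>+ y. U j y \<partial>lborel)"
      by (subst nn_integral_prod_vec_nth) (auto simp: reindex)
    finally show ?thesis .
  qed
  thus ?thesis using C(1) by blast
qed

text \<open>Preimages of null sets under \<open>block_dot w\<close> are null: \<open>w\<close> is
  extended to a basis, and the product formula is applied to the indicator of the null set in the
  coordinate of \<open>w\<close> and to 1 in the others.\<close>

lemma AE_block_dot: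
  fixes w :: "real ^ 'm" and P :: "real ^ 'k \<Rightarrow> bool"
  assumes "w \<noteq> 0" and AE: "AE y in lborel. P y"
  shows "AE x in lborel. P (block_dot w x)"
proof -
  obtain B where B: "{w} \<subseteq> B" "independent B" "UNIV \<subseteq> span B"
    using maximal_independent_subset_extend[of "{w}" UNIV] \<open>w \<noteq> 0\<close> by auto
  hence span: "span (id ` B) = UNIV" by auto
  have card: "card B = CARD('m)"
    using B(2,3) by (metis basis_card_eq_dim dim_UNIV DIM_cart DIM_real mult.right_neutral subset_UNIV)
  obtain Z where Z: "Z \<in> null_sets lborel" "{y. \<not> P y} \<subseteq> Z"
    using AE by (auto simp: eventually_ae_filter)
  have [measurable]: "Z \<in> sets borel" using Z(1) by auto
  define U where "U j = (if j = w then indicator Z else (\<lambda>_::real ^ 'k. 1 :: ennreal))" for j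
  have meas: "U j \<in> borel_measurable borel" for j by (simp add: U_def)
  have finB: "finite B" using card by (intro card_ge_0_finite) auto
  have "w \<in> B" using B(1) by auto
  \<comment> \<open>The other factors are infinite, but a zero factor makes the product 0 in
    \<open>ennreal\<close>.\<close>
  have "(\<Prod>j\<in>B. \<integral>\<^sup>+ y. U j y \<partial>lborel) = 0"
    using finB \<open>w \<in> B\<close> Z(1) by (intro prod_zero bexI[of _ w]) (auto simp: U_def null_sets_def)
  hence "(\<integral>\<^sup>+ x. (\<Prod>j\<in>B. U j (block_dot j x)) \<partial>lborel) = 0"
    using nn_integral_prod_block_dot[OF span card, where 'k='k] meas by force
  moreover have "(\<Prod>j\<in>B. U j (block_dot j x)) = indicator Z (block_dot w x)" for x
    using finB \<open>w \<in> B\<close> by (subst prod.remove[of _ w]) (auto simp: U_def)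
  ultimately have "AE x in lborel. indicator Z (block_dot w x) = (0::ennreal)"
    by (simp add: nn_integral_0_iff_AE)
  thus ?thesis by eventually_elim (use Z(2) in \<open>auto simp: indicator_def split: if_splits\<close>)
qed

section \<open>Nonnegative weights\<close>

text \<open>Enumerating the integers turns the integral into a countable series.\<close>

lemma borel_measurable_nn_integral_count_space_int:
  fixes f :: "int \<Rightarrow> 'a \<Rightarrow> ennreal"
  assumes [measurable]: "\<And>n. f n \<in> borel_measurable M"
  shows "(\<lambda>y. \<integral>\<^sup>+ n. f n y \<partial>count_space UNIV) \<in> borel_measurable M"
proof -
  have bij: "bij_betw (from_nat_into (UNIV :: int set)) UNIV UNIV"
    by (intro bij_betw_from_nat_into) (auto simp: infinite_UNIV_int)
  have "(\<integral>\<^sup>+ n. f n y \<partial>count_space UNIV) = (\<Sum>k. f (from_nat_into UNIV k) y)" for y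
    using nn_integral_bij_count_space[OF bij, of "\<lambda>n. f n y"] by (simp add: nn_integral_count_space_nat)
  thus ?thesis by simp
qed

text \<open>Splitting each function by its profile, the integrand at \<open>x\<close> involves one tuple of
  dyadic indices. Once the largest factor \<open>x i (n i)\<close> is singled out, the remaining powers of two
  are absorbed by functions \<open>U j r\<close>, one for each \<open>j\<close> in a vertex \<open>K\<close> of the hypersimplex, whose
  integrals are bounded uniformly in the dyadic index \<open>r = n i\<close>.\<close>

lemma bounded_form_nonneg_weights:
  fixes I :: "'i set" and v :: "'i \<Rightarrow> real ^ 'm" and a c :: "'i \<Rightarrow> real"
  assumes fin: "finite I"
    and span: "\<And>K. K \<subseteq> I \<Longrightarrow> card K = CARD('m) \<Longrightarrow> span (v ` K) = UNIV"
    and nonzero: "\<And>j. j \<in> I \<Longrightarrow> v j \<noteq> 0"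
    and ac: "\<And>j. j \<in> I \<Longrightarrow> 0 < a j" "\<And>j. j \<in> I \<Longrightarrow> a j \<le> c j" "\<And>j. j \<in> I \<Longrightarrow> c j < 1"
    and sum_c: "sum c I = real CARD('m)" and sum_a: "1 \<le> sum a I"
  shows "\<exists>C\<ge>0. \<forall>f :: 'i \<Rightarrow> real ^ 'k \<Rightarrow> real.
    (\<forall>j\<in>I. f j \<in> borel_measurable borel \<and> (\<forall>y. 0 \<le> f j y) \<and>
       (\<integral>\<^sup>+ y. ennreal ((norm y powr (CARD('k) * (c j - a j)) * f j y) powr (1 / a j)) \<partial>lborel) \<le> 1) \<longrightarrow>
    (\<integral>\<^sup>+ x. ennreal (\<Prod>j\<in>I. f j (block_dot (v j) x)) \<partial>lborel) \<le> ennreal C"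
proof -
  define m where "m = CARD('m)"
  have "m > 0" by (simp add: m_def)
  have "I \<noteq> {}" using sum_a by auto
  \<comment> \<open>The distance of the \<open>c j\<close> to the endpoints of (0, 1); it is
    positive because \<open>0 < a j \<le> c j < 1\<close>.\<close>
  define \<epsilon> where "\<epsilon> = Min ((\<lambda>j. min (c j) (1 - c j)) ` I)"
  have "\<epsilon> \<le> min (c j) (1 - c j)" if "j \<in> I" for j
    unfolding \<epsilon>_def using fin that by (intro Min_le) auto
  hence \<epsilon>: "\<epsilon> \<le> c j" "\<epsilon> \<le> 1 - c j" if "j \<in> I" for j using that by force+
  have "\<epsilon> > 0"
    unfolding \<epsilon>_def using fin \<open>I \<noteq> {}\<close> ac by (subst Min_gr_iff) force+
  define \<eta> where "\<eta> = \<epsilon> / (real (card I) + 1)"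
  have "\<eta> > 0" using \<open>\<epsilon> > 0\<close> by (simp add: \<eta>_def)
  define q where "q = 2 powr (- \<eta>)"
  have q: "0 < q" "q < 1" using \<open>\<eta> > 0\<close> by (auto simp: q_def powr_less_one)
  define B where "B = 2 / (1 - q)"
  have "B \<ge> 0" using q by (simp add: B_def)
  have "\<forall>j\<in>I. \<exists>D>0. \<forall>f :: real ^ 'k \<Rightarrow> real.
    f \<in> borel_measurable borel \<longrightarrow> (\<forall>y. 0 \<le> f y) \<longrightarrow>
    (\<integral>\<^sup>+ y. ennreal ((norm y powr (CARD('k) * (c j - a j)) * f y) powr (1 / a j)) \<partial>lborel) \<le> 1 \<longrightarrow>
    (\<exists>(E :: int \<Rightarrow> (real ^ 'k) set) (x :: int \<Rightarrow> real).
       (\<forall>n. E n \<in> sets borel \<and> emeasure lborel (E n) \<le> ennreal (D * 2 powr n)) \<and>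
       (\<forall>n. 0 \<le> x n) \<and> (\<integral>\<^sup>+ n. ennreal (x n) \<partial>count_space UNIV) \<le> 1 \<and>
       (AE y in lborel. 0 < f y \<longrightarrow> (\<exists>n. y \<in> E n \<and> f y \<le> D * x n powr a j * 2 powr (- (c j * n)))))"
    using ex_weak_type_profile[where 'a="real ^ 'k"] ac by simp
  from bchoice[OF this] obtain D where D_pos: "\<And>j. j \<in> I \<Longrightarrow> 0 < D j" and D: "\<And>j f. j \<in> I \<Longrightarrow>
    f \<in> borel_measurable borel \<Longrightarrow> (\<forall>y. 0 \<le> f y) \<Longrightarrow>
    (\<integral>\<^sup>+ y. ennreal ((norm (y :: real ^ 'k) powr (CARD('k) * (c j - a j)) * f y) powr (1 / a j)) \<partial>lborel) \<le> 1 \<Longrightarrow>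
    (\<exists>(E :: int \<Rightarrow> (real ^ 'k) set) (x :: int \<Rightarrow> real).
       (\<forall>n. E n \<in> sets borel \<and> emeasure lborel (E n) \<le> ennreal (D j * 2 powr n)) \<and>
       (\<forall>n. 0 \<le> x n) \<and> (\<integral>\<^sup>+ n. ennreal (x n) \<partial>count_space UNIV) \<le> 1 \<and>
       (AE y in lborel. 0 < f y \<longrightarrow> (\<exists>n. y \<in> E n \<and> f y \<le> D j * x n powr a j * 2 powr (- (c j * n)))))"
    by blast
  define \<K> where "\<K> = {K. K \<subseteq> I \<and> card K = m}"
  have "finite \<K>" unfolding \<K>_def using fin by simp
  have "\<forall>K\<in>\<K>. \<exists>C\<ge>0. \<forall>U :: 'i \<Rightarrow> real ^ 'k \<Rightarrow> ennreal. (\<forall>j\<in>K. U j \<in> borel_measurable borel) \<longrightarrow>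
    (\<integral>\<^sup>+ x. (\<Prod>j\<in>K. U j (block_dot (v j) x)) \<partial>lborel) =
      ennreal C * (\<Prod>j\<in>K. \<integral>\<^sup>+ y. U j y \<partial>lborel)"
    unfolding \<K>_def m_def by (intro ballI nn_integral_prod_block_dot span) auto
  from bchoice[OF this] obtain CK where CK_nonneg: "\<And>K. K \<in> \<K> \<Longrightarrow> 0 \<le> CK K"
    and CK: "\<And>K (U :: 'i \<Rightarrow> real ^ 'k \<Rightarrow> ennreal). K \<in> \<K> \<Longrightarrow> (\<forall>j\<in>K. U j \<in> borel_measurable borel) \<Longrightarrow>
      (\<integral>\<^sup>+ x. (\<Prod>j\<in>K. U j (block_dot (v j) x)) \<partial>lborel) = ennreal (CK K) * (\<Prod>j\<in>K. \<integral>\<^sup>+ y. U j y \<partial>lborel)"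
    by blast
  define DD where "DD = prod D I"
  have "DD > 0" unfolding DD_def using D_pos by (intro prod_pos)
  \<comment> \<open>The factors come from the profile bounds of all functions, from the change of
    variables for \<open>K\<close>, and from the integrals of the functions \<open>U r j\<close>
    with \<open>j\<close> in \<open>K\<close>.\<close>
  define T where "T K = DD * CK K * (\<Prod>j\<in>K. D j * B)" for K
  have T_nonneg: "T K \<ge> 0" if "K \<in> \<K>" for K
  proof -
    have "0 \<le> D j" if "j \<in> K" for j
      using that \<open>K \<in> \<K>\<close> D_pos[of j] by (auto simp: \<K>_def)
    hence "0 \<le> (\<Prod>j\<in>K. D j * B)" using \<open>B \<ge> 0\<close> by (auto intro: prod_nonneg)
    thus ?thesis unfolding T_def using CK_nonneg[OF that] \<open>DD > 0\<close> by auto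
  qed
  \<comment> \<open>The dominant index \<open>i\<close> and the vertex \<open>K\<close> vary with
    the point of integration, so all finitely many choices are summed.\<close>
  define C where "C = (\<Sum>i\<in>I. \<Sum>K\<in>\<K>. T K)"
  have "C \<ge> 0" unfolding C_def using T_nonneg by (intro sum_nonneg)
  moreover have "(\<integral>\<^sup>+ x. ennreal (\<Prod>j\<in>I. f j (block_dot (v j) x)) \<partial>lborel) \<le> ennreal C"
    if f: "\<forall>j\<in>I. f j \<in> borel_measurable borel \<and> (\<forall>y. 0 \<le> f j y) \<and>
       (\<integral>\<^sup>+ y. ennreal ((norm y powr (CARD('k) * (c j - a j)) * f j y) powr (1 / a j)) \<partial>lborel) \<le> 1"
    for f :: "'i \<Rightarrow> real ^ 'k \<Rightarrow> real"
  proof -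
    have "\<forall>j\<in>I. \<exists>Ex :: (int \<Rightarrow> (real ^ 'k) set) \<times> (int \<Rightarrow> real).
       (\<forall>n. fst Ex n \<in> sets borel \<and> emeasure lborel (fst Ex n) \<le> ennreal (D j * 2 powr n)) \<and>
       (\<forall>n. 0 \<le> snd Ex n) \<and> (\<integral>\<^sup>+ n. ennreal (snd Ex n) \<partial>count_space UNIV) \<le> 1 \<and>
       (AE y in lborel. 0 < f j y \<longrightarrow>
          (\<exists>n. y \<in> fst Ex n \<and> f j y \<le> D j * snd Ex n powr a j * 2 powr (- (c j * n))))"
      using D f by (simp add: split_paired_Ex)
    from bchoice[OF this] obtain Ex :: "'i \<Rightarrow> (int \<Rightarrow> (real ^ 'k) set) \<times> (int \<Rightarrow> real)"
      where Ex: "\<And>j. j \<in> I \<Longrightarrow> (\<forall>n. fst (Ex j) n \<in> sets borel \<and> emeasure lborel (fst (Ex j) n) \<le> ennreal (D j * 2 powr n)) \<and>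
       (\<forall>n. 0 \<le> snd (Ex j) n) \<and> (\<integral>\<^sup>+ n. ennreal (snd (Ex j) n) \<partial>count_space UNIV) \<le> 1 \<and>
       (AE y in lborel. 0 < f j y \<longrightarrow>
          (\<exists>n. y \<in> fst (Ex j) n \<and> f j y \<le> D j * snd (Ex j) n powr a j * 2 powr (- (c j * n))))"
      by blast
    define E where "E j = fst (Ex j)" for j
    define x where "x j = snd (Ex j)" for j
    have E_sets: "E j n \<in> sets borel" and E_measure: "emeasure lborel (E j n) \<le> ennreal (D j * 2 powr n)"
      and x_nonneg: "0 \<le> x j n" and sum_x: "(\<integral>\<^sup>+ n. ennreal (x j n) \<partial>count_space UNIV) \<le> 1"
      and AE_f: "AE y in lborel. 0 < f j y \<longrightarrow>
          (\<exists>n. y \<in> E j n \<and> f j y \<le> D j * x j n powr a j * 2 powr (- (c j * n)))"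
      if "j \<in> I" for j n
      using Ex[OF that] unfolding E_def x_def by auto
    have x_le_1: "x j n \<le> 1" if "j \<in> I" for j n
    proof -
      have "ennreal (x j n) \<le> 1"
        by (rule order_trans[OF nn_integral_ge_point sum_x]) (use that in auto)
      thus ?thesis using x_nonneg[OF that] by (simp add: ennreal_le_1)
    qed
    \<comment> \<open>The part \<open>2 powr (- n)\<close> cancels the measure bound of
      \<open>E j n\<close>; what remains is \<open>q\<close> to the power of the distance between
      \<open>n\<close> and \<open>r\<close>, summable over \<open>n\<close> uniformly in
      \<open>r\<close>.\<close>
    define h where "h r n = 2 powr (- (real_of_int n + \<eta> * \<bar>real_of_int n - real_of_int r\<bar>))" for r n :: int
    define U where "U r j y = (\<integral>\<^sup>+ n. ennreal (h r n) * indicator (E j n) y \<partial>count_space UNIV)" for r j y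
    have U_meas: "U r j \<in> borel_measurable borel" if "j \<in> I" for r j
      unfolding U_def using E_sets[OF that]
      by (intro borel_measurable_nn_integral_count_space_int borel_measurable_times_ennreal
          borel_measurable_indicator) auto
    have U_int: "(\<integral>\<^sup>+ y. U r j y \<partial>lborel) \<le> ennreal (D j * B)" if "j \<in> I" for r j
    proof -
      have "(\<integral>\<^sup>+ y. U r j y \<partial>lborel) =
          (\<integral>\<^sup>+ n. \<integral>\<^sup>+ y. ennreal (h r n) * indicator (E j n) y \<partial>lborel \<partial>count_space UNIV)"
        unfolding U_def using E_sets[OF that]
        by (intro nn_integral_count_space_nn_integral borel_measurable_times_ennreal
            borel_measurable_indicator) auto
      also have "\<dots> = (\<integral>\<^sup>+ n. ennreal (h r n) * emeasure lborel (E j n) \<partial>count_space UNIV)"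
        using E_sets[OF that] by (subst nn_integral_cmult_indicator) auto
      also have "\<dots> \<le> (\<integral>\<^sup>+ n. ennreal (D j) * ennreal (q powr \<bar>real_of_int (n - r)\<bar>) \<partial>count_space UNIV)"
      proof (intro nn_integral_mono)
        fix n
        have "ennreal (h r n) * emeasure lborel (E j n) \<le> ennreal (h r n) * ennreal (D j * 2 powr n)"
          by (intro mult_left_mono E_measure that) auto
        also have "\<dots> = ennreal (h r n * (D j * 2 powr n))"
          using D_pos[OF that] by (simp add: h_def ennreal_mult')
        also have "h r n * (D j * 2 powr n) = D j * 2 powr (- (real_of_int n + \<eta> * \<bar>real_of_int n - real_of_int r\<bar>) + n)"
          unfolding powr_add by (simp add: h_def)
        also have "\<dots> = D j * q powr \<bar>real_of_int (n - r)\<bar>"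
          by (simp add: q_def powr_powr)
        finally show "ennreal (h r n) * emeasure lborel (E j n) \<le> ennreal (D j) * ennreal (q powr \<bar>real_of_int (n - r)\<bar>)"
          using D_pos[OF that] by (simp add: ennreal_mult')
      qed
      also have "\<dots> = ennreal (D j) * (\<integral>\<^sup>+ n. ennreal (q powr \<bar>real_of_int (n - r)\<bar>) \<partial>count_space UNIV)"
        by (rule nn_integral_cmult) auto
      also have "\<dots> \<le> ennreal (D j) * ennreal B"
        unfolding B_def by (intro mult_left_mono nn_integral_count_space_geometric q) auto
      also have "\<dots> = ennreal (D j * B)"
        using D_pos[OF that] by (simp add: ennreal_mult')
      finally show ?thesis .
    qed
    define F where "F i K r y = ennreal (DD * x i r) * (\<Prod>j\<in>K. U r j (block_dot (v j) y))"
      for i K r and y :: "real ^ 'k ^ 'm"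
    have F_meas: "F i K r \<in> borel_measurable borel" if "K \<in> \<K>" for i K r
      unfolding F_def using that U_meas
      by (intro borel_measurable_times_ennreal borel_measurable_prod_ennreal
          measurable_compose[OF borel_measurable_block_dot]) (auto simp: \<K>_def)
    have F_int: "(\<integral>\<^sup>+ y. F i K r y \<partial>lborel) \<le> ennreal (T K) * ennreal (x i r)" if "K \<in> \<K>" "i \<in> I" for i K r
    proof -
      have K: "j \<in> I" if "j \<in> K" for j using that \<open>K \<in> \<K>\<close> by (auto simp: \<K>_def)
      have "(\<lambda>y. \<Prod>j\<in>K. U r j (block_dot (v j) y)) \<in> borel_measurable borel"
        using U_meas K
        by (intro borel_measurable_prod_ennreal measurable_compose[OF borel_measurable_block_dot]) auto
      hence "(\<integral>\<^sup>+ y. F i K r y \<partial>lborel) = ennreal (DD * x i r) * (\<integral>\<^sup>+ y. (\<Prod>j\<in>K. U r j (block_dot (v j) y)) \<partial>lborel)"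
        unfolding F_def by (intro nn_integral_cmult) auto
      also have "\<dots> = ennreal (DD * x i r) * (ennreal (CK K) * (\<Prod>j\<in>K. \<integral>\<^sup>+ y. U r j y \<partial>lborel))"
        using U_meas K by (subst CK[OF that(1)]) auto
      also have "\<dots> \<le> ennreal (DD * x i r) * (ennreal (CK K) * (\<Prod>j\<in>K. ennreal (D j * B)))"
        by (intro mult_left_mono prod_mono_ennreal U_int K) auto
      also have "(\<Prod>j\<in>K. ennreal (D j * B)) = ennreal (\<Prod>j\<in>K. D j * B)"
        using D_pos K \<open>B \<ge> 0\<close> by (intro prod_ennreal) (auto simp: less_imp_le)
      also have "ennreal (DD * x i r) * (ennreal (CK K) * ennreal (\<Prod>j\<in>K. D j * B)) = ennreal (T K) * ennreal (x i r)"
      proof -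
        have "0 \<le> (\<Prod>j\<in>K. D j * B)"
          using D_pos K \<open>B \<ge> 0\<close> by (intro prod_nonneg) (auto simp: less_imp_le)
        thus ?thesis unfolding T_def
          using \<open>DD > 0\<close> x_nonneg[OF that(2), of r] CK_nonneg[OF that(1)]
          by (simp add: ennreal_mult mult_ac)
      qed
      finally show ?thesis .
    qed
    have pointwise: "ennreal (\<Prod>j\<in>I. f j (block_dot (v j) y)) \<le>
        (\<Sum>i\<in>I. \<Sum>K\<in>\<K>. \<integral>\<^sup>+ r. F i K r y \<partial>count_space UNIV)"
      if y: "\<forall>j\<in>I. 0 < f j (block_dot (v j) y) \<longrightarrow> (\<exists>n. block_dot (v j) y \<in> E j n \<and>
           f j (block_dot (v j) y) \<le> D j * x j n powr a j * 2 powr (- (c j * n)))" for y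
    proof (cases "\<exists>j\<in>I. f j (block_dot (v j) y) = 0")
      case True
      hence "(\<Prod>j\<in>I. f j (block_dot (v j) y)) = 0" using fin by (simp add: prod_zero)
      thus ?thesis by simp
    next
      case False
      hence "\<forall>j\<in>I. \<exists>n. block_dot (v j) y \<in> E j n \<and>
           f j (block_dot (v j) y) \<le> D j * x j n powr a j * 2 powr (- (c j * n))"
        using y f by (metis less_eq_real_def)
      from bchoice[OF this] obtain n :: "'i \<Rightarrow> int" where n: "\<And>j. j \<in> I \<Longrightarrow> block_dot (v j) y \<in> E j (n j)"
        "\<And>j. j \<in> I \<Longrightarrow> f j (block_dot (v j) y) \<le> D j * x j (n j) powr a j * 2 powr (- (c j * n j))"
        by blast
      \<comment> \<open>The minus sign selects the index with the largest profile value; its level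
        \<open>n i\<close> becomes the common level \<open>r\<close>.\<close>
      define i where "i = arg_min_on (\<lambda>j. - x j (n j)) I"
      have i: "i \<in> I" "\<And>j. j \<in> I \<Longrightarrow> x j (n j) \<le> x i (n i)"
        using arg_min_if_finite(1)[OF fin \<open>I \<noteq> {}\<close>, of "\<lambda>j. - x j (n j)"]
          arg_min_least[OF fin \<open>I \<noteq> {}\<close>, of _ "\<lambda>j. - x j (n j)"] by (auto simp: i_def)
      obtain K where K: "K \<subseteq> I" "card K = m"
        and K_le: "(\<Sum>j\<in>K. n j + \<eta> * \<bar>real_of_int (n j) - n i\<bar>) \<le> (\<Sum>j\<in>I. c j * n j)"
        using vertex_dominates_interior_point[OF fin sum_c[folded m_def] \<open>m > 0\<close> i(1) \<epsilon> \<open>\<epsilon> > 0\<close> \<eta>_def,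
            of "\<lambda>j. real_of_int (n j)"] by auto
      have "K \<in> \<K>" using K by (simp add: \<K>_def)
      have h_nonneg: "0 \<le> h r k" for r k by (simp add: h_def)
      have "(\<Prod>j\<in>I. f j (block_dot (v j) y)) \<le> (\<Prod>j\<in>I. D j * x j (n j) powr a j * 2 powr (- (c j * n j)))"
        using f n(2) by (intro prod_mono) auto
      also have "\<dots> = DD * (\<Prod>j\<in>I. x j (n j) powr a j) * 2 powr (\<Sum>j\<in>I. - (c j * n j))"
        using fin by (simp add: prod.distrib DD_def powr_sum)
      \<comment> \<open>\<open>prod_powr_le_Max\<close> collapses the profile values to the largest
        one, and \<open>K_le\<close> moves the power of two to the vertex \<open>K\<close>.\<close>
      also have "\<dots> \<le> DD * x i (n i) * 2 powr (- (\<Sum>j\<in>K. n j + \<eta> * \<bar>real_of_int (n j) - n i\<bar>))"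
        using \<open>DD > 0\<close> K_le x_nonneg[OF i(1)] i ac x_le_1[OF i(1)] x_nonneg sum_a fin
        by (intro mult_mono prod_powr_le_Max mult_nonneg_nonneg prod_nonneg powr_mono)
           (auto simp: sum_negf less_imp_le)
      also have "2 powr (- (\<Sum>j\<in>K. n j + \<eta> * \<bar>real_of_int (n j) - n i\<bar>)) = (\<Prod>j\<in>K. h (n i) (n j))"
        using K(1) fin finite_subset by (subst sum_negf[symmetric], subst powr_sum) (auto simp: h_def)
      finally have "ennreal (\<Prod>j\<in>I. f j (block_dot (v j) y)) \<le> ennreal (DD * x i (n i) * (\<Prod>j\<in>K. h (n i) (n j)))"
        by (rule ennreal_leI)
      also have "\<dots> = ennreal (DD * x i (n i)) * (\<Prod>j\<in>K. ennreal (h (n i) (n j)))"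
        using h_nonneg by (simp add: prod_ennreal ennreal_mult'' prod_nonneg)
      also have "\<dots> \<le> F i K (n i) y"
        unfolding F_def
      proof (intro mult_left_mono prod_mono_ennreal)
        fix j assume "j \<in> K"
        hence "block_dot (v j) y \<in> E j (n j)" using K(1) n(1) by auto
        hence "ennreal (h (n i) (n j)) = ennreal (h (n i) (n j)) * indicator (E j (n j)) (block_dot (v j) y)"
          by simp
        also have "\<dots> \<le> U (n i) j (block_dot (v j) y)"
          unfolding U_def by (rule nn_integral_ge_point) auto
        finally show "ennreal (h (n i) (n j)) \<le> U (n i) j (block_dot (v j) y)" .
      qed auto
      also have "\<dots> \<le> (\<integral>\<^sup>+ r. F i K r y \<partial>count_space UNIV)"
        by (rule nn_integral_ge_point) auto
      also have "\<dots> \<le> (\<Sum>K\<in>\<K>. \<integral>\<^sup>+ r. F i K r y \<partial>count_space UNIV)"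
        using \<open>K \<in> \<K>\<close> \<open>finite \<K>\<close>
        by (intro member_le_sum[where f="\<lambda>K. \<integral>\<^sup>+ r. F i K r y \<partial>count_space UNIV"]) auto
      also have "\<dots> \<le> (\<Sum>i\<in>I. \<Sum>K\<in>\<K>. \<integral>\<^sup>+ r. F i K r y \<partial>count_space UNIV)"
        using i(1) fin
        by (intro member_le_sum[where f="\<lambda>i. \<Sum>K\<in>\<K>. \<integral>\<^sup>+ r. F i K r y \<partial>count_space UNIV"]) auto
      finally show ?thesis .
    qed
    have "AE y in lborel. \<forall>j\<in>I. 0 < f j (block_dot (v j) y) \<longrightarrow> (\<exists>n. block_dot (v j) y \<in> E j n \<and>
           f j (block_dot (v j) y) \<le> D j * x j n powr a j * 2 powr (- (c j * n)))"
      using fin by (intro AE_finite_allI AE_block_dot[OF nonzero AE_f])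
    hence "(\<integral>\<^sup>+ y. ennreal (\<Prod>j\<in>I. f j (block_dot (v j) y)) \<partial>lborel) \<le>
        (\<integral>\<^sup>+ y. (\<Sum>i\<in>I. \<Sum>K\<in>\<K>. \<integral>\<^sup>+ r. F i K r y \<partial>count_space UNIV) \<partial>lborel)"
      by (intro nn_integral_mono_AE) (auto elim!: eventually_mono intro: pointwise)
    also have "\<dots> = (\<Sum>i\<in>I. \<Sum>K\<in>\<K>. \<integral>\<^sup>+ y. \<integral>\<^sup>+ r. F i K r y \<partial>count_space UNIV \<partial>lborel)"
    proof -
      have "(\<lambda>y. \<integral>\<^sup>+ r. F i K r y \<partial>count_space UNIV) \<in> borel_measurable lborel" if "K \<in> \<K>" for i K
        using F_meas[OF that] by (intro borel_measurable_nn_integral_count_space_int) auto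
      thus ?thesis by (simp add: nn_integral_sum borel_measurable_sum)
    qed
    also have "\<dots> = (\<Sum>i\<in>I. \<Sum>K\<in>\<K>. \<integral>\<^sup>+ r. \<integral>\<^sup>+ y. F i K r y \<partial>lborel \<partial>count_space UNIV)"
      using F_meas by (intro sum.cong refl nn_integral_count_space_nn_integral) auto
    also have "\<dots> \<le> (\<Sum>i\<in>I. \<Sum>K\<in>\<K>. \<integral>\<^sup>+ r. ennreal (T K) * ennreal (x i r) \<partial>count_space UNIV)"
      by (intro sum_mono nn_integral_mono F_int)
    also have "\<dots> = (\<Sum>i\<in>I. \<Sum>K\<in>\<K>. ennreal (T K) * (\<integral>\<^sup>+ r. ennreal (x i r) \<partial>count_space UNIV))"
      by (subst nn_integral_cmult) auto
    \<comment> \<open>Only the sum over the common level was left, and the profile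
      \<open>x i\<close> is summable.\<close>
    also have "\<dots> \<le> (\<Sum>i\<in>I. \<Sum>K\<in>\<K>. ennreal (T K) * 1)"
      by (intro sum_mono mult_left_mono sum_x) auto
    also have "\<dots> = ennreal C"
      unfolding C_def using T_nonneg by (simp add: sum_ennreal sum_nonneg del: sum_constant)
    finally show ?thesis .
  qed
  ultimately show ?thesis by blast
qed

section \<open>General weights\<close>

text \<open>An injective linear map is bounded below, and the norm of its value is at most the sum
  of \<open>CARD('m)\<close> block norms, so some block reaches the average.\<close>

lemma ex_block_dot_lower_bound:
  fixes v :: "'i \<Rightarrow> real ^ 'm" and K :: "'i set"
  assumes span: "span (v ` K) = UNIV" and card: "card K = CARD('m)"
  shows "\<exists>\<delta>>0. \<forall>x :: real ^ 'k ^ 'm. \<exists>j\<in>K. \<delta> * norm x \<le> norm (block_dot (v j) x)"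
proof -
  have "finite K" using card by (intro card_ge_0_finite) auto
  then obtain \<sigma> :: "'m \<Rightarrow> 'i" where \<sigma>: "bij_betw \<sigma> UNIV K"
    using card by (metis bij_betw_iff_card finite)
  hence range: "range \<sigma> = K" by (simp add: bij_betw_def)
  let ?T = "\<lambda>x :: real ^ 'k ^ 'm. \<chi> i. block_dot (v (\<sigma> i)) x"
  obtain B where B: "B > 0" "\<And>x. B * norm x \<le> norm (?T x)"
    using linear_inj_bounded_below_pos[of ?T] linear_inj_block_dots[of v \<sigma>] span range by auto
  let ?\<delta> = "B / CARD('m)"
  have "\<exists>j\<in>K. ?\<delta> * norm x \<le> norm (block_dot (v j) x)" for x :: "real ^ 'k ^ 'm"
  proof (rule ccontr)
    assume "\<not> (\<exists>j\<in>K. ?\<delta> * norm x \<le> norm (block_dot (v j) x))"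
    hence less: "norm (block_dot (v (\<sigma> i)) x) < ?\<delta> * norm x" for i
      using range by (meson not_le rangeI subsetD order_refl)
    have "norm (?T x) \<le> (\<Sum>i\<in>UNIV. norm (block_dot (v (\<sigma> i)) x))"
      unfolding norm_vec_def by (rule order_trans[OF L2_set_le_sum]) auto
    also have "\<dots> < (\<Sum>i\<in>(UNIV :: 'm set). ?\<delta> * norm x)"
      by (intro sum_strict_mono less) auto
    also have "\<dots> = B * norm x" by simp
    finally show False using B(2)[of x] by simp
  qed
  thus ?thesis using B(1) by (intro exI[of _ ?\<delta>]) auto
qed

text \<open>At most \<open>m - 1\<close> of the blocks can be much smaller than \<open>x\<close>. The weights of the remaining
  ones, and the negative weights, are replaced by powers of \<open>norm x\<close>, whose total exponent is
  nonpositive, and then spread again over the same indices in proportion to \<open>1 - a j\<close>, which keeps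
  every new weight exponent nonnegative and every \<open>c' j\<close> below 1.\<close>

lemma bounded_form_weights:
  fixes I :: "'i set" and v :: "'i \<Rightarrow> real ^ 'm" and a l :: "'i \<Rightarrow> real"
  assumes fin: "finite I"
    and span: "\<And>K. K \<subseteq> I \<Longrightarrow> card K = CARD('m) \<Longrightarrow> span (v ` K) = UNIV"
    and nonzero: "\<And>j. j \<in> I \<Longrightarrow> v j \<noteq> 0"
    and a: "\<And>j. j \<in> I \<Longrightarrow> 0 < a j" "\<And>j. j \<in> I \<Longrightarrow> a j < 1"
    and c: "\<And>j. j \<in> I \<Longrightarrow> a j + l j / CARD('k) < 1"
    and sum_c: "(\<Sum>j\<in>I. a j + l j / CARD('k)) = real CARD('m)" and sum_a: "1 \<le> sum a I"
    and sum_l: "\<And>A. A \<subseteq> I \<Longrightarrow> card (I - A) < CARD('m) \<Longrightarrow> 0 \<le> sum l A"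
  shows "\<exists>C\<ge>0. \<forall>f :: 'i \<Rightarrow> real ^ 'k \<Rightarrow> real.
    (\<forall>j\<in>I. f j \<in> borel_measurable borel \<and> (\<forall>y. 0 \<le> f j y) \<and>
       (\<integral>\<^sup>+ y. ennreal ((norm y powr l j * f j y) powr (1 / a j)) \<partial>lborel) \<le> 1) \<longrightarrow>
    (\<integral>\<^sup>+ x. ennreal (\<Prod>j\<in>I. f j (block_dot (v j) x)) \<partial>lborel) \<le> ennreal C"
proof -
  let ?k = "real CARD('k)"
  have k: "?k > 0" by simp
  define \<K> where "\<K> = {K. K \<subseteq> I \<and> card K = CARD('m)}"
  have fin\<K>: "finite \<K>" unfolding \<K>_def using fin by simp
  have "\<forall>K\<in>\<K>. \<exists>\<delta>>0. \<forall>x :: real ^ 'k ^ 'm. \<exists>j\<in>K. \<delta> * norm x \<le> norm (block_dot (v j) x)"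
    unfolding \<K>_def by (intro ballI ex_block_dot_lower_bound span) auto
  from bchoice[OF this] obtain \<delta>K where \<delta>K: "\<And>K. K \<in> \<K> \<Longrightarrow> 0 < \<delta>K K"
    "\<And>K (x :: real ^ 'k ^ 'm). K \<in> \<K> \<Longrightarrow> \<exists>j\<in>K. \<delta>K K * norm x \<le> norm (block_dot (v j) x)"
    by blast
  \<comment> \<open>One bound valid for every \<open>K\<close>; the entry 1 keeps the minimum over a
    nonempty set.\<close>
  define \<delta> where "\<delta> = Min (insert 1 (\<delta>K ` \<K>))"
  have "\<delta> > 0" unfolding \<delta>_def using fin\<K> \<delta>K(1) by (subst Min_gr_iff) auto
  have \<delta>_le: "\<delta> \<le> \<delta>K K" if "K \<in> \<K>" for K
    unfolding \<delta>_def using fin\<K> that by (intro Min_le) auto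
  have few_small: "card {j\<in>I. norm (block_dot (v j) x) < \<delta> * norm x} < CARD('m)"
    for x :: "real ^ 'k ^ 'm"
  proof (rule ccontr)
    let ?S = "{j\<in>I. norm (block_dot (v j) x) < \<delta> * norm x}"
    assume "\<not> card ?S < CARD('m)"
    then obtain K where K: "K \<subseteq> ?S" "card K = CARD('m)"
      by (meson not_less obtain_subset_with_card_n)
    hence "K \<in> \<K>" by (auto simp: \<K>_def)
    then obtain j where j: "j \<in> K" "\<delta>K K * norm x \<le> norm (block_dot (v j) x)" using \<delta>K(2) by blast
    have "\<delta> * norm x \<le> \<delta>K K * norm x" by (intro mult_right_mono \<delta>_le \<open>K \<in> \<K>\<close>) auto
    with j K(1) show False by force
  qed
  have "\<forall>j\<in>I. \<exists>B>0. \<forall>x :: real ^ 'k ^ 'm. norm (block_dot (v j) x) \<le> B * norm x"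
    using linear_bounded_pos[OF linear_block_dot] by blast
  from bchoice[OF this] obtain LB where LB: "\<And>j. j \<in> I \<Longrightarrow> 0 < LB j"
    "\<And>j (x :: real ^ 'k ^ 'm). j \<in> I \<Longrightarrow> norm (block_dot (v j) x) \<le> LB j * norm x"
    by blast
  \<comment> \<open>The index sets among which weights may be redistributed: they contain all
    negative weights and have nonnegative total weight.\<close>
  define \<A> where "\<A> = {A. A \<subseteq> I \<and> (\<forall>j\<in>I - A. 0 \<le> l j) \<and> 0 \<le> sum l A}"
  have fin\<A>: "finite \<A>" unfolding \<A>_def using fin by simp
  \<comment> \<open>Chosen so that \<open>l'\<close> keeps the total weight on \<open>A\<close>.
    There \<open>c' A j = a j + \<theta> A * (1 - a j)\<close> lies between \<open>a j\<close> and 1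
    as long as \<open>0 \<le> \<theta> A < 1\<close>. For empty \<open>A\<close> the quotient is
    0.\<close>
  define \<theta> where "\<theta> A = sum l A / (?k * (\<Sum>j\<in>A. 1 - a j))" for A
  define l' where "l' A j = (if j \<in> A then \<theta> A * (1 - a j) * ?k else l j)" for A j
  define c' where "c' A j = a j + l' A j / ?k" for A j
  have pos: "0 < (\<Sum>j\<in>A. 1 - a j)" if "A \<in> \<A>" "A \<noteq> {}" for A
    using that a fin by (intro sum_pos) (auto simp: \<A>_def intro: finite_subset)
  have \<theta>_nonneg: "0 \<le> \<theta> A" if "A \<in> \<A>" for A
  proof (cases "A = {}")
    case False
    show ?thesis unfolding \<theta>_def
      using that pos[OF that False] by (intro divide_nonneg_pos mult_pos_pos k) (auto simp: \<A>_def)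
  qed (simp add: \<theta>_def)
  \<comment> \<open>The hypothesis \<open>c\<close> reads \<open>l j < ?k * (1 - a j)\<close>; it is
    summed over \<open>A\<close>.\<close>
  have \<theta>_less: "\<theta> A < 1" if "A \<in> \<A>" for A
  proof (cases "A = {}")
    case False
    have A: "A \<subseteq> I" "finite A" using that fin by (auto simp: \<A>_def intro: finite_subset)
    have "sum l A < (\<Sum>j\<in>A. ?k * (1 - a j))"
    proof (rule sum_strict_mono[OF A(2) False])
      fix j assume "j \<in> A"
      hence "l j / ?k < 1 - a j" using c[of j] A(1) by auto
      thus "l j < ?k * (1 - a j)" using k by (simp only: pos_divide_less_eq mult.commute)
    qed
    hence "sum l A < ?k * (\<Sum>j\<in>A. 1 - a j)" by (simp add: sum_distrib_left)
    thus ?thesis unfolding \<theta>_def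
      using mult_pos_pos[OF k pos[OF that False]] by (simp only: divide_less_eq_1_pos)
  qed (simp add: \<theta>_def)
  have sum_l': "sum (l' A) A = sum l A" if "A \<in> \<A>" for A
  proof (cases "A = {}")
    case False
    have "sum (l' A) A = \<theta> A * ?k * (\<Sum>j\<in>A. 1 - a j)"
      by (simp add: l'_def sum_distrib_left mult_ac)
    thus ?thesis using pos[OF that False] by (simp add: \<theta>_def)
  qed simp
  have l'_nonneg: "0 \<le> l' A j" if "A \<in> \<A>" "j \<in> I" for A j
    using that \<theta>_nonneg[OF that(1)] a(2)[OF that(2)] by (auto simp: l'_def \<A>_def)
  have "\<forall>A\<in>\<A>. \<exists>C\<ge>0. \<forall>f :: 'i \<Rightarrow> real ^ 'k \<Rightarrow> real.
    (\<forall>j\<in>I. f j \<in> borel_measurable borel \<and> (\<forall>y. 0 \<le> f j y) \<and>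
       (\<integral>\<^sup>+ y. ennreal ((norm y powr (?k * (c' A j - a j)) * f j y) powr (1 / a j)) \<partial>lborel) \<le> 1) \<longrightarrow>
    (\<integral>\<^sup>+ x. ennreal (\<Prod>j\<in>I. f j (block_dot (v j) x)) \<partial>lborel) \<le> ennreal C"
  proof
    fix A assume A: "A \<in> \<A>"
    hence AI: "A \<subseteq> I" by (simp add: \<A>_def)
    have split: "sum h I = sum h A + sum h (I - A)" for h :: "'i \<Rightarrow> real"
      using sum.subset_diff[OF AI fin, of h] by simp
    show "\<exists>C\<ge>0. \<forall>f :: 'i \<Rightarrow> real ^ 'k \<Rightarrow> real.
      (\<forall>j\<in>I. f j \<in> borel_measurable borel \<and> (\<forall>y. 0 \<le> f j y) \<and>
         (\<integral>\<^sup>+ y. ennreal ((norm y powr (?k * (c' A j - a j)) * f j y) powr (1 / a j)) \<partial>lborel) \<le> 1) \<longrightarrow>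
      (\<integral>\<^sup>+ x. ennreal (\<Prod>j\<in>I. f j (block_dot (v j) x)) \<partial>lborel) \<le> ennreal C"
    proof (rule bounded_form_nonneg_weights[OF fin span nonzero a(1) _ _ _ sum_a])
      fix j assume "j \<in> I"
      show "a j \<le> c' A j" using l'_nonneg[OF A \<open>j \<in> I\<close>] by (simp add: c'_def)
      show "c' A j < 1"
      proof (cases "j \<in> A")
        case True
        have "\<theta> A * (1 - a j) < 1 * (1 - a j)"
          using \<theta>_less[OF A] a(2)[OF \<open>j \<in> I\<close>] by (intro mult_strict_right_mono) auto
        thus ?thesis using True by (simp add: c'_def l'_def)
      next
        case False
        thus ?thesis using c[OF \<open>j \<in> I\<close>] by (simp add: c'_def l'_def)
      qed
    next
      have "sum (l' A) I = sum l I"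
        unfolding split using sum_l'[OF A] by (simp add: l'_def)
      thus "sum (c' A) I = real CARD('m)"
        using sum_c by (simp add: c'_def sum.distrib flip: sum_divide_distrib)
    qed
  qed
  from bchoice[OF this] obtain CA where CA_nonneg: "\<And>A. A \<in> \<A> \<Longrightarrow> 0 \<le> CA A"
    and CA: "\<And>A (f :: 'i \<Rightarrow> real ^ 'k \<Rightarrow> real). A \<in> \<A> \<Longrightarrow>
    (\<forall>j\<in>I. f j \<in> borel_measurable borel \<and> (\<forall>y. 0 \<le> f j y) \<and>
       (\<integral>\<^sup>+ y. ennreal ((norm y powr (?k * (c' A j - a j)) * f j y) powr (1 / a j)) \<partial>lborel) \<le> 1) \<Longrightarrow>
    (\<integral>\<^sup>+ x. ennreal (\<Prod>j\<in>I. f j (block_dot (v j) x)) \<partial>lborel) \<le> ennreal (CA A)"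
    by blast
  \<comment> \<open>The maximum serves both signs of \<open>l j\<close>: a lower bound on the block
    size if \<open>l j \<ge> 0\<close>, an upper bound if \<open>l j < 0\<close>. The last factor
    pays for the new weight \<open>l' A j \<ge> 0\<close>.\<close>
  define M where "M A j = max (\<delta> powr (- l j)) (LB j powr (- l j)) * LB j powr l' A j" for A j
  define MA where "MA A = prod (M A) A" for A
  have M_nonneg: "0 \<le> M A j" for A j by (simp add: M_def le_max_iff_disj)
  have MA_nonneg: "0 \<le> MA A" for A unfolding MA_def by (intro prod_nonneg M_nonneg)
  define C where "C = (\<Sum>A\<in>\<A>. MA A * CA A)"
  have "C \<ge> 0" unfolding C_def by (intro sum_nonneg mult_nonneg_nonneg MA_nonneg CA_nonneg)
  moreover have "(\<integral>\<^sup>+ x. ennreal (\<Prod>j\<in>I. f j (block_dot (v j) x)) \<partial>lborel) \<le> ennreal C"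
    if f: "\<forall>j\<in>I. f j \<in> borel_measurable borel \<and> (\<forall>y. 0 \<le> f j y) \<and>
       (\<integral>\<^sup>+ y. ennreal ((norm y powr l j * f j y) powr (1 / a j)) \<partial>lborel) \<le> 1"
    for f :: "'i \<Rightarrow> real ^ 'k \<Rightarrow> real"
  proof -
    \<comment> \<open>The weighted norm of \<open>g A j\<close> with exponent \<open>l' A j\<close>
      is that of \<open>f j\<close> with exponent \<open>l j\<close>.\<close>
    define g where "g A j y = norm y powr (l j - l' A j) * f j y" for A j and y :: "real ^ 'k"
    have g_meas [measurable]: "g A j \<in> borel_measurable borel" if "j \<in> I" for A j
    proof -
      have [measurable]: "f j \<in> borel_measurable borel" using f that by auto
      show ?thesis unfolding g_def by measurable
    qed
    have g_nonneg: "0 \<le> g A j y" if "j \<in> I" for A j y using f that by (simp add: g_def)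
    have prod_meas: "(\<lambda>x. ennreal (\<Prod>j\<in>I. g A j (block_dot (v j) x))) \<in> borel_measurable borel" for A
      using g_meas
      by (intro measurable_compose[OF _ measurable_ennreal] borel_measurable_prod
          measurable_compose[OF borel_measurable_block_dot]) auto
    have pointwise: "ennreal (\<Prod>j\<in>I. f j (block_dot (v j) x)) \<le>
        (\<Sum>A\<in>\<A>. ennreal (MA A) * ennreal (\<Prod>j\<in>I. g A j (block_dot (v j) x)))"
      if nz: "\<forall>j\<in>I. block_dot (v j) x \<noteq> 0" for x :: "real ^ 'k ^ 'm"
    proof -
      define X where "X = norm x"
      define z where "z j = norm (block_dot (v j) x)" for j
      have z: "0 < z j" "z j \<le> LB j * X" if "j \<in> I" for j
        using nz LB(2) that by (auto simp: z_def X_def)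
      have "I \<noteq> {}" using sum_a by auto
      then obtain j0 where "j0 \<in> I" by blast
      have "x \<noteq> 0"
        using nz \<open>j0 \<in> I\<close> linear_0[OF linear_block_dot] by metis
      hence "X > 0" by (simp add: X_def)
      \<comment> \<open>Indices outside \<open>A\<close> have small blocks, so by
        \<open>few_small\<close> there are fewer than \<open>m\<close> of them and
        \<open>sum_l\<close> applies to \<open>A\<close>.\<close>
      define A where "A = {j\<in>I. \<delta> * X \<le> z j \<or> l j < 0}"
      have "card (I - A) \<le> card {j\<in>I. norm (block_dot (v j) x) < \<delta> * norm x}"
        using fin by (intro card_mono) (auto simp: A_def z_def X_def)
      also note few_small
      finally have "card (I - A) < CARD('m)" .
      hence A: "A \<in> \<A>" using sum_l[of A] by (auto simp: \<A>_def A_def)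
      have AI: "A \<subseteq> I" by (auto simp: A_def)
      have factor: "X powr (l j - l' A j) \<le> M A j * z j powr (l j - l' A j)" if "j \<in> A" for j
      proof -
        have j: "j \<in> I" using that AI by auto
        note zj = z[OF j] and LBj = LB(1)[OF j]
        have 1: "X powr l j \<le> max (\<delta> powr (- l j)) (LB j powr (- l j)) * z j powr l j"
        proof (cases "l j < 0")
          case True
          have "(LB j * X) powr l j \<le> z j powr l j"
            using True zj by (intro powr_mono2') auto
          hence "X powr l j \<le> LB j powr (- l j) * z j powr l j"
            using LBj \<open>X > 0\<close> by (simp add: powr_mult powr_minus field_simps)
          also have "\<dots> \<le> max (\<delta> powr (- l j)) (LB j powr (- l j)) * z j powr l j"
            by (intro mult_right_mono) auto
          finally show ?thesis .
        next
          case False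
          hence "\<delta> * X \<le> z j" using that by (auto simp: A_def)
          hence "(\<delta> * X) powr l j \<le> z j powr l j"
            using False \<open>\<delta> > 0\<close> \<open>X > 0\<close> by (intro powr_mono2) auto
          hence "X powr l j \<le> \<delta> powr (- l j) * z j powr l j"
            using \<open>\<delta> > 0\<close> \<open>X > 0\<close> by (simp add: powr_mult powr_minus field_simps)
          also have "\<dots> \<le> max (\<delta> powr (- l j)) (LB j powr (- l j)) * z j powr l j"
            by (intro mult_right_mono) auto
          finally show ?thesis .
        qed
        have "z j powr l' A j \<le> (LB j * X) powr l' A j"
          using l'_nonneg[OF A j] zj by (intro powr_mono2) auto
        hence 2: "X powr (- l' A j) \<le> LB j powr l' A j * z j powr (- l' A j)"
          using LBj \<open>X > 0\<close> zj by (simp add: powr_mult powr_minus field_simps)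
        have "X powr l j * X powr (- l' A j) \<le>
            (max (\<delta> powr (- l j)) (LB j powr (- l j)) * z j powr l j) * (LB j powr l' A j * z j powr (- l' A j))"
          by (intro mult_mono 1 2) (auto simp: le_max_iff_disj)
        also have "\<dots> = M A j * (z j powr l j * z j powr (- l' A j))"
          by (simp add: M_def mult_ac)
        finally show ?thesis by (simp flip: powr_add)
      qed
      \<comment> \<open>The old and new weights have the same sum over \<open>A\<close>, so the
        powers of \<open>norm x\<close> cancel.\<close>
      have "1 = X powr (\<Sum>j\<in>A. l j - l' A j)"
        using sum_l'[OF A] \<open>X > 0\<close> by (simp add: sum_subtractf)
      also have "\<dots> = (\<Prod>j\<in>A. X powr (l j - l' A j))"
        using \<open>X > 0\<close> by (intro powr_sum) (use AI fin finite_subset in auto)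
      also have "\<dots> \<le> (\<Prod>j\<in>A. M A j * z j powr (l j - l' A j))"
        by (intro prod_mono conjI factor) auto
      also have "\<dots> = MA A * (\<Prod>j\<in>A. z j powr (l j - l' A j))"
        by (simp add: prod.distrib MA_def)
      \<comment> \<open>Off \<open>A\<close> the exponent is 0. The factor is then 1 only because
        \<open>z j > 0\<close>, as \<open>0 powr 0 = 0\<close>; this is why points with a vanishing
        block product are excluded.\<close>
      also have "(\<Prod>j\<in>A. z j powr (l j - l' A j)) = (\<Prod>j\<in>I. z j powr (l j - l' A j))"
        using z(1) by (intro prod.mono_neutral_left fin AI) (force simp: l'_def)
      finally have ge1: "1 \<le> MA A * (\<Prod>j\<in>I. z j powr (l j - l' A j))" .
      have "(\<Prod>j\<in>I. f j (block_dot (v j) x)) \<le>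
          MA A * (\<Prod>j\<in>I. z j powr (l j - l' A j)) * (\<Prod>j\<in>I. f j (block_dot (v j) x))"
        using f mult_right_mono[OF ge1, of "\<Prod>j\<in>I. f j (block_dot (v j) x)"] by (simp add: prod_nonneg)
      also have "\<dots> = MA A * (\<Prod>j\<in>I. g A j (block_dot (v j) x))"
        by (simp add: g_def z_def prod.distrib)
      finally have "ennreal (\<Prod>j\<in>I. f j (block_dot (v j) x)) \<le>
          ennreal (MA A * (\<Prod>j\<in>I. g A j (block_dot (v j) x)))"
        by (rule ennreal_leI)
      also have "\<dots> = ennreal (MA A) * ennreal (\<Prod>j\<in>I. g A j (block_dot (v j) x))"
        using MA_nonneg by (simp add: ennreal_mult')
      also have "\<dots> \<le> (\<Sum>A\<in>\<A>. ennreal (MA A) * ennreal (\<Prod>j\<in>I. g A j (block_dot (v j) x)))"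
        using A fin\<A>
        by (intro member_le_sum[where f="\<lambda>A. ennreal (MA A) * ennreal (\<Prod>j\<in>I. g A j (block_dot (v j) x))"]) auto
      finally show ?thesis .
    qed
    have "AE y in lborel. y \<noteq> (0 :: real ^ 'k)" by (rule AE_lborel_singleton)
    hence "AE x in lborel. \<forall>j\<in>I. block_dot (v j) (x :: real ^ 'k ^ 'm) \<noteq> 0"
      using fin nonzero by (intro AE_finite_allI AE_block_dot) auto
    hence "(\<integral>\<^sup>+ x. ennreal (\<Prod>j\<in>I. f j (block_dot (v j) x)) \<partial>lborel) \<le>
        (\<integral>\<^sup>+ x. (\<Sum>A\<in>\<A>. ennreal (MA A) * ennreal (\<Prod>j\<in>I. g A j (block_dot (v j) x))) \<partial>lborel)"
      by (intro nn_integral_mono_AE) (auto elim!: eventually_mono intro: pointwise)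
    also have "\<dots> = (\<Sum>A\<in>\<A>. ennreal (MA A) * (\<integral>\<^sup>+ x. ennreal (\<Prod>j\<in>I. g A j (block_dot (v j) x)) \<partial>lborel))"
      using prod_meas by (simp add: nn_integral_sum nn_integral_cmult)
    also have "\<dots> \<le> (\<Sum>A\<in>\<A>. ennreal (MA A) * ennreal (CA A))"
    proof (intro sum_mono mult_left_mono CA ballI conjI allI g_meas g_nonneg)
      fix A j assume "A \<in> \<A>" "j \<in> I"
      have "norm y powr (?k * (c' A j - a j)) * g A j y = norm y powr l j * f j y" for y
        by (simp add: c'_def g_def mult.assoc[symmetric] flip: powr_add)
      thus "(\<integral>\<^sup>+ y. ennreal ((norm y powr (?k * (c' A j - a j)) * g A j y) powr (1 / a j)) \<partial>lborel) \<le> 1"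
        using f \<open>j \<in> I\<close> by simp
    qed auto
    also have "\<dots> = ennreal C"
      unfolding C_def using MA_nonneg CA_nonneg
      by (subst sum_ennreal[symmetric]) (auto simp: ennreal_mult)
    finally show ?thesis .
  qed
  ultimately show ?thesis by blast
qed

section \<open>Weighted norms: vanishing, normalization, Borel representatives\<close>

lemma weighted_Lp_norm_eq_0_imp_AE:
  fixes f :: "'a::euclidean_space \<Rightarrow> real"
  assumes [measurable]: "f \<in> borel_measurable borel" and "\<And>y. 0 \<le> f y" and "weighted_Lp_norm p a f = 0"
  shows "AE y in lborel. f y = 0"
proof -
  let ?I = "\<integral>\<^sup>+ y. ennreal (\<bar>norm y powr a * f y\<bar> powr p) \<partial>(lborel :: 'a measure)"
  have "?I = 0"
  proof (cases ?I)
    case (real r)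
    thus ?thesis using assms(3)
      by (auto simp: weighted_Lp_norm_def Lp_norm_def Let_def nn_integral_completion ennreal_eq_0_iff split: if_splits)
  next
    case top
    thus ?thesis using assms(3)
      by (simp add: weighted_Lp_norm_def Lp_norm_def Let_def nn_integral_completion)
  qed
  hence "AE y in lborel. ennreal (\<bar>norm y powr a * f y\<bar> powr p) = 0"
    by (subst (asm) nn_integral_0_iff_AE) auto
  \<comment> \<open>The weight vanishes only at the origin, so elsewhere \<open>f\<close> itself
    must vanish.\<close>
  moreover have "AE y in lborel. y \<noteq> (0 :: 'a)" by (rule AE_lborel_singleton)
  ultimately show ?thesis
    by eventually_elim (auto simp: ennreal_eq_0_iff)
qed

lemma weighted_Lp_norm_normalize:
  fixes f :: "'a::euclidean_space \<Rightarrow> real"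
  assumes [measurable]: "f \<in> borel_measurable borel" and f: "\<And>y. 0 \<le> f y"
    and w: "weighted_Lp_norm p a f = ennreal w" "0 < w" and "0 < p"
  shows "(\<integral>\<^sup>+ y. ennreal ((norm y powr a * (f y / w)) powr p) \<partial>lborel) = 1"
proof -
  let ?I = "\<integral>\<^sup>+ y. ennreal ((norm y powr a * f y) powr p) \<partial>(lborel :: 'a measure)"
  have norm_eq: "weighted_Lp_norm p a f = (if ?I = \<infinity> then \<infinity> else ennreal (enn2real ?I powr (1 / p)))"
    using f by (simp add: weighted_Lp_norm_def Lp_norm_def Let_def nn_integral_completion)
  then obtain r where r: "?I = ennreal r" "0 \<le> r" using w by (cases ?I) auto
  hence "r powr (1 / p) = w" using norm_eq w by simp
  hence "w powr p = r" using r(2) \<open>0 < p\<close> by (auto simp: powr_powr)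
  have "(\<integral>\<^sup>+ y. ennreal ((norm y powr a * (f y / w)) powr p) \<partial>lborel) =
      (\<integral>\<^sup>+ y. ennreal (1 / r) * ennreal ((norm y powr a * f y) powr p) \<partial>(lborel :: 'a measure))"
    using f w \<open>w powr p = r\<close> r(2)
    by (intro nn_integral_cong) (simp add: powr_divide flip: ennreal_mult)
  also have "\<dots> = ennreal (1 / r) * ennreal r"
    by (subst nn_integral_cmult) (auto simp: r)
  also have "\<dots> = 1"
    using \<open>w powr p = r\<close> w(2) r(2) by (subst ennreal_mult[symmetric]) auto
  finally show ?thesis .
qed

lemma weighted_Lp_norm_cong_AE:
  assumes "AE y in lborel. f y = g y"
  shows "weighted_Lp_norm p a f = weighted_Lp_norm p a g"
proof -
  have "(\<integral>\<^sup>+ y. ennreal (\<bar>norm y powr a * f y\<bar> powr p) \<partial>lborel) =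
      (\<integral>\<^sup>+ y. ennreal (\<bar>norm y powr a * g y\<bar> powr p) \<partial>lborel)"
    by (intro nn_integral_cong_AE) (use assms in \<open>auto elim: eventually_mono\<close>)
  thus ?thesis by (simp add: weighted_Lp_norm_def Lp_norm_def nn_integral_completion)
qed

lemma ex_borel_nonneg_version:
  fixes f :: "'a::euclidean_space \<Rightarrow> real"
  assumes "f \<in> borel_measurable lebesgue" "\<And>y. 0 \<le> f y"
  shows "\<exists>g \<in> borel_measurable borel. (\<forall>y. 0 \<le> g y) \<and> (AE y in lborel. f y = g y)"
proof -
  obtain g where g: "g \<in> borel_measurable lborel" "AE y in lborel. f y = g y"
    using completion_ex_borel_measurable_real[OF assms(1)] by blast
  \<comment> \<open>The Borel version may be negative on a null set; the absolute value repairs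
    this.\<close>
  have "AE y in lborel. f y = \<bar>g y\<bar>"
    using g(2) by eventually_elim (metis assms(2) abs_of_nonneg)
  thus ?thesis using g(1) by (intro bexI[of _ "\<lambda>y. \<bar>g y\<bar>"]) auto
qed

section \<open>Reduction of the theorem to the normalized estimate\<close>

theorem theorem1p3:
  fixes N :: nat
    and v :: "nat \<Rightarrow> real ^ 'm"
    and p l :: "nat \<Rightarrow> real"
  assumes distinct: "inj_on v {1..N}"
    and nonzero: "\<And>j. j \<in> {1..N} \<Longrightarrow> v j \<noteq> 0"
    and noncollinear:
      "\<And>i j. i \<in> {1..N} \<Longrightarrow> j \<in> {1..N} \<Longrightarrow> i \<noteq> j \<Longrightarrow> \<not> collinear {0, v i, v j}"
    and generic: "generic (v ` {1..N})"
    and exponents: "\<And>j. j \<in> {1..N} \<Longrightarrow> 1 / p j \<in> {0<..<1}"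
    and i: "(\<Sum>j=1..N. 1 / p j + l j / real CARD('k)) = real CARD('m)"
    and ii: "\<And>V. subspace V \<Longrightarrow> V \<noteq> {0} \<Longrightarrow> V \<noteq> UNIV \<Longrightarrow>
       (\<Sum>j\<in>{j\<in>{1..N}. v j \<notin> V}. 1 / p j + l j / real CARD('k)) > real CARD('m) - real (dim V)"
    and iii: "\<And>V. subspace V \<Longrightarrow> (\<Sum>j\<in>{j\<in>{1..N}. v j \<notin> V}. l j) \<ge> 0"
    and iv: "(\<Sum>j=1..N. 1 / p j) \<ge> 1"
  shows "\<exists>C::real. C \<ge> 0 \<and>
    (\<forall>f :: nat \<Rightarrow> real ^ 'k \<Rightarrow> real.
       (\<forall>j\<in>{1..N}. f j \<in> borel_measurable lebesgue \<and> (\<forall>y. 0 \<le> f j y)) \<longrightarrow>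
       Lambda_form N v f \<le> ennreal C * (\<Prod>j=1..N. weighted_Lp_norm (p j) (l j) (f j)))"
proof -
  let ?k = "real CARD('k)" and ?m = "CARD('m)"
  let ?I = "{1..N}"
  define a where "a j = 1 / p j" for j
  have a: "0 < a j" "a j < 1" if "j \<in> ?I" for j using exponents[OF that] by (auto simp: a_def)
  have p: "p j = 1 / a j" for j by (simp add: a_def)
  have inj: "inj_on v K" if "K \<subseteq> ?I" for K using inj_on_subset[OF distinct that] .
  have indep: "independent (v ` K)" "span (v ` K) = UNIV" if "K \<subseteq> ?I" "card K = ?m" for K
    using generic[unfolded generic_def, rule_format, of "v ` K"] card_image[OF inj[OF that(1)]] that
    by (simp_all add: image_mono)
  have not_span: "v i \<notin> span {v j}" if "i \<in> ?I" "j \<in> ?I" "i \<noteq> j" for i j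
    using noncollinear[OF that(2,1)] that(3) by (auto simp: span_singleton collinear_lemma)
  \<comment> \<open>In dimension 1 noncollinearity leaves a single vector, and
    \<open>1 / p j < 1\<close> contradicts (iv). Dimension at least 2 makes the line through
    \<open>v j\<close> a proper subspace.\<close>
  have "?m \<noteq> 1"
  proof
    assume m1: "?m = 1"
    have "?I \<noteq> {}" using iv by force
    then obtain j where j: "j \<in> ?I" by blast
    have "span {v j} = UNIV" using indep(2)[of "{j}"] j m1 by simp
    hence "?I = {j}" using not_span j by blast
    hence "(\<Sum>j=1..N. 1 / p j) = a j" by (simp add: a_def)
    thus False using iv a[OF j] by simp
  qed
  hence m: "1 < ?m" by (metis One_nat_def nat_neq_iff less_one zero_less_card_finite less_numeral_extra(3))
  \<comment> \<open>Condition (ii) for the line through \<open>v j\<close>, which contains no other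
    vector of the family, is subtracted from (i).\<close>
  have c: "a j + l j / ?k < 1" if j: "j \<in> ?I" for j
  proof -
    have dim: "dim (span {v j}) = 1" using nonzero[OF j] by simp
    have "{i\<in>?I. v i \<notin> span {v j}} = ?I - {j}"
      using not_span[OF _ j] by (auto simp: span_base)
    moreover have "span {v j} \<noteq> {0}" using nonzero[OF j] by (metis span_base singletonD singletonI)
    moreover have "span {v j} \<noteq> UNIV" using dim m by (metis dim_UNIV DIM_cart DIM_real mult.right_neutral less_irrefl)
    ultimately have "real ?m - 1 < (\<Sum>i\<in>?I - {j}. 1 / p i + l i / ?k)"
      using ii[of "span {v j}"] dim by simp
    also have "\<dots> = real ?m - (1 / p j + l j / ?k)"
      using i j by (subst sum_diff1) auto
    finally show ?thesis by (simp add: a_def)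
  qed
  \<comment> \<open>Summands below 1 with total \<open>m\<close> require at least \<open>m\<close>
    indices; this lets small index sets be extended to size \<open>m\<close> below.\<close>
  have "real ?m \<le> (\<Sum>j\<in>?I. 1)"
    unfolding i[symmetric] using c by (intro sum_mono) (auto simp: a_def less_imp_le)
  hence "?m \<le> card ?I" by simp
  \<comment> \<open>Condition (iii) for the span of the vectors outside \<open>A\<close>. That span
    contains no \<open>v j\<close> with \<open>j\<close> in \<open>A\<close>: together with
    \<open>j\<close>, the outside indices extend to \<open>m\<close> indices with independent
    vectors.\<close>
  have sum_l: "0 \<le> sum l A" if A: "A \<subseteq> ?I" "card (?I - A) < ?m" for A
  proof -
    have "{j\<in>?I. v j \<notin> span (v ` (?I - A))} = A"
    proof (intro equalityI subsetI)
      fix j assume "j \<in> {j\<in>?I. v j \<notin> span (v ` (?I - A))}"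
      thus "j \<in> A" by (auto intro: span_base)
    next
      fix j assume j: "j \<in> A"
      hence jI: "j \<in> ?I" using A(1) by auto
      have "card (insert j (?I - A)) \<le> ?m" using A(2) by (simp add: card_insert_if)
      then obtain K where K: "insert j (?I - A) \<subseteq> K" "K \<subseteq> ?I" "card K = ?m"
        using exists_subset_between[of "insert j (?I - A)" ?m ?I] \<open>?m \<le> card ?I\<close> jI by auto
      have "j \<in> K" using K(1) by simp
      have "v ` (?I - A) \<subseteq> v ` K - {v j}"
        using K(1) j jI by (auto simp: inj_on_eq_iff[OF distinct])
      moreover have "v j \<notin> span (v ` K - {v j})"
        using indep(1)[OF K(2,3)] \<open>j \<in> K\<close> unfolding dependent_def by blast
      ultimately have "v j \<notin> span (v ` (?I - A))" using span_mono by blast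
      thus "j \<in> {j\<in>?I. v j \<notin> span (v ` (?I - A))}" using j A(1) by auto
    qed
    thus ?thesis using iii[of "span (v ` (?I - A))"] by simp
  qed
  have "\<exists>C\<ge>0. \<forall>f :: nat \<Rightarrow> real ^ 'k \<Rightarrow> real.
    (\<forall>j\<in>?I. f j \<in> borel_measurable borel \<and> (\<forall>y. 0 \<le> f j y) \<and>
       (\<integral>\<^sup>+ y. ennreal ((norm y powr l j * f j y) powr (1 / a j)) \<partial>lborel) \<le> 1) \<longrightarrow>
    (\<integral>\<^sup>+ x. ennreal (\<Prod>j\<in>?I. f j (block_dot (v j) x)) \<partial>lborel) \<le> ennreal C"
    using i iv by (intro bounded_form_weights indep(2) nonzero a c sum_l) (auto simp: a_def)
  then obtain C where "C \<ge> 0" and C: "\<And>f :: nat \<Rightarrow> real ^ 'k \<Rightarrow> real.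
    (\<forall>j\<in>?I. f j \<in> borel_measurable borel \<and> (\<forall>y. 0 \<le> f j y) \<and>
       (\<integral>\<^sup>+ y. ennreal ((norm y powr l j * f j y) powr (1 / a j)) \<partial>lborel) \<le> 1) \<Longrightarrow>
    (\<integral>\<^sup>+ x. ennreal (\<Prod>j\<in>?I. f j (block_dot (v j) x)) \<partial>lborel) \<le> ennreal C"
    by blast
  \<comment> \<open>\<open>C + 1\<close> is positive, so the right-hand side is infinite whenever
    the product of the norms is.\<close>
  have "Lambda_form N v f \<le> ennreal (C + 1) * (\<Prod>j=1..N. weighted_Lp_norm (p j) (l j) (f j))"
    if f: "\<forall>j\<in>?I. f j \<in> borel_measurable lebesgue \<and> (\<forall>y. 0 \<le> f j y)"
    for f :: "nat \<Rightarrow> real ^ 'k \<Rightarrow> real"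
  proof -
    have "\<forall>j\<in>?I. \<exists>g. g \<in> borel_measurable borel \<and> (\<forall>y. 0 \<le> g y) \<and> (AE y in lborel. f j y = g y)"
      using ex_borel_nonneg_version f by blast
    from bchoice[OF this] obtain g where g: "\<And>j. j \<in> ?I \<Longrightarrow> g j \<in> borel_measurable borel"
      "\<And>j y. j \<in> ?I \<Longrightarrow> 0 \<le> g j y" "\<And>j. j \<in> ?I \<Longrightarrow> AE y in lborel. f j y = g j y"
      by blast
    define W where "W j = weighted_Lp_norm (p j) (l j) (g j)" for j
    have W: "weighted_Lp_norm (p j) (l j) (f j) = W j" if "j \<in> ?I" for j
      unfolding W_def using g(3)[OF that] by (rule weighted_Lp_norm_cong_AE)
    have "AE x in lborel. \<forall>j\<in>?I. f j (block_dot (v j) x) = g j (block_dot (v j) x)"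
      using nonzero g(3) by (intro AE_finite_allI AE_block_dot[where P="\<lambda>y. f _ y = g _ y"]) auto
    hence "Lambda_form N v f = (\<integral>\<^sup>+ x. ennreal (\<Prod>j\<in>?I. g j (block_dot (v j) x)) \<partial>lborel)"
      unfolding Lambda_form_def nn_integral_completion
      by (intro nn_integral_cong_AE) (auto elim!: eventually_mono intro!: prod.cong arg_cong[where f=ennreal])
    also have "\<dots> \<le> ennreal (C + 1) * (\<Prod>j\<in>?I. W j)"
    proof -
      \<comment> \<open>A zero norm is treated first: it forces the form to vanish even when other
        norms are infinite, matching \<open>0 * \<infinity> = 0\<close>.\<close>
      consider (zero) j where "j \<in> ?I" "W j = 0" | (infinite) "\<forall>j\<in>?I. W j \<noteq> 0" "\<exists>j\<in>?I. W j = \<infinity>"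
        | (finite) "\<forall>j\<in>?I. W j \<noteq> 0" "\<forall>j\<in>?I. W j \<noteq> \<infinity>" by blast
      thus ?thesis
      proof cases
        case zero
        hence "AE y in lborel. g j y = 0"
          unfolding W_def using g(1,2) by (intro weighted_Lp_norm_eq_0_imp_AE) auto
        hence "AE x in lborel. g j (block_dot (v j) (x :: real ^ 'k ^ 'm)) = 0"
          using nonzero zero(1) by (intro AE_block_dot) auto
        moreover have "(\<Prod>j\<in>?I. g j (block_dot (v j) x)) = 0" if "g j (block_dot (v j) x) = 0"
          for x :: "real ^ 'k ^ 'm"
          using zero(1) that by (intro prod_zero) auto
        ultimately have "AE x in lborel. ennreal (\<Prod>j\<in>?I. g j (block_dot (v j) (x :: real ^ 'k ^ 'm))) = 0"
          by (auto elim!: eventually_mono simp only: ennreal_0)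
        hence "(\<integral>\<^sup>+ x. ennreal (\<Prod>j\<in>?I. g j (block_dot (v j) (x :: real ^ 'k ^ 'm))) \<partial>lborel) = (\<integral>\<^sup>+ (x :: real ^ 'k ^ 'm). 0 \<partial>lborel)"
          by (rule nn_integral_cong_AE)
        thus ?thesis by simp
      next
        case infinite
        hence "(\<Prod>j\<in>?I. W j) = \<infinity>" by (auto simp: ennreal_prod_eq_top)
        thus ?thesis using \<open>C \<ge> 0\<close> by (simp add: ennreal_mult_top)
      next
        case finite
        \<comment> \<open>With all norms positive and finite, multilinearity reduces the bound to
          functions of norm 1.\<close>
        define w where "w j = enn2real (W j)" for j
        have w: "W j = ennreal (w j)" "0 < w j" if "j \<in> ?I" for j
          using finite that by (auto simp: w_def less_top enn2real_positive_iff zero_less_iff_neq_zero)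
        let ?h = "\<lambda>j y. g j y / w j"
        have h: "(\<integral>\<^sup>+ x. ennreal (\<Prod>j\<in>?I. ?h j (block_dot (v j) (x :: real ^ 'k ^ 'm))) \<partial>lborel) \<le> ennreal C"
        proof (rule C, intro ballI conjI allI)
          fix j assume j: "j \<in> ?I"
          have [measurable]: "g j \<in> borel_measurable borel" using g(1) j by auto
          show "?h j \<in> borel_measurable borel" by measurable
          show "0 \<le> ?h j y" for y using g(2) w j by (simp add: less_imp_le)
          have "(\<integral>\<^sup>+ y. ennreal ((norm y powr l j * ?h j y) powr p j) \<partial>lborel) = 1"
            using w[OF j] g(2) j a(1)[OF j] by (intro weighted_Lp_norm_normalize) (auto simp: W_def p)
          thus "(\<integral>\<^sup>+ y. ennreal ((norm y powr l j * ?h j y) powr (1 / a j)) \<partial>lborel) \<le> 1"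
            by (simp add: p)
        qed
        have w_prod: "0 < prod w ?I" using w by (intro prod_pos) auto
        have h_meas: "(\<lambda>x :: real ^ 'k ^ 'm. ennreal (\<Prod>j\<in>?I. ?h j (block_dot (v j) x))) \<in> borel_measurable borel"
          using g(1)
          by (intro measurable_compose[OF _ measurable_ennreal] borel_measurable_prod borel_measurable_divide
              borel_measurable_const measurable_compose[OF borel_measurable_block_dot]) auto
        have "(\<integral>\<^sup>+ x. ennreal (\<Prod>j\<in>?I. g j (block_dot (v j) (x :: real ^ 'k ^ 'm))) \<partial>lborel) =
            (\<integral>\<^sup>+ x. ennreal (prod w ?I) * ennreal (\<Prod>j\<in>?I. ?h j (block_dot (v j) (x :: real ^ 'k ^ 'm))) \<partial>lborel)"
        proof (intro nn_integral_cong)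
          fix x :: "real ^ 'k ^ 'm"
          have "(\<Prod>j\<in>?I. g j (block_dot (v j) x)) = prod w ?I * (\<Prod>j\<in>?I. ?h j (block_dot (v j) x))"
            unfolding prod.distrib[symmetric] using w(2) by (intro prod.cong) (auto simp: less_imp_neq[symmetric])
          thus "ennreal (\<Prod>j\<in>?I. g j (block_dot (v j) x)) =
              ennreal (prod w ?I) * ennreal (\<Prod>j\<in>?I. ?h j (block_dot (v j) x))"
            using w_prod by (simp add: ennreal_mult')
        qed
        also have "\<dots> = ennreal (prod w ?I) * (\<integral>\<^sup>+ x. ennreal (\<Prod>j\<in>?I. ?h j (block_dot (v j) (x :: real ^ 'k ^ 'm))) \<partial>lborel)"
          by (rule nn_integral_cmult) (use h_meas in \<open>simp only: measurable_lborel2\<close>)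
        also have "\<dots> \<le> ennreal (prod w ?I) * ennreal (C + 1)"
          by (intro mult_left_mono order_trans[OF h] ennreal_leI) auto
        also have "ennreal (prod w ?I) = (\<Prod>j\<in>?I. W j)"
          using w by (subst prod_ennreal[symmetric]) (auto simp: less_imp_le)
        finally show ?thesis by (simp add: mult.commute)
      qed
    qed
    also have "(\<Prod>j\<in>?I. W j) = (\<Prod>j=1..N. weighted_Lp_norm (p j) (l j) (f j))"
      using W by (intro prod.cong) auto
    finally show ?thesis .
  qed
  thus ?thesis using \<open>C \<ge> 0\<close> by (intro exI[of _ "C + 1"]) auto
qed

end
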